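(* Let $n\ge 5$. For every integer $r$ with $2\le r\le n-1$, there are no subgroups of $K_n$ with index $r$. Moreover, every nontrivial representation (homomorphism) $\rho:K_n\to S_n$ is transitive.
   Context: $K_n$ is the commutator subgroup of the braid group $B_n$ on $n$ strands. $S_n$ is the symmetric group of degree $n$. A homomorphism $\rho:K_n\to S_n$ is called transitive if $\rho(K_n)$ acts transitively on $\{1,2,\dots,n\}$. *)

theory Defs
  imports "HOL-Algebra.Sym_Groups" "HOL-Algebra.Group_Action"
begin

text \<open>
  Groups given by generators and relations. A letter \<open>(x, True)\<close> stands for the generator
  \<open>x\<close> and \<open>(x, False)\<close> for its formal inverse. The relation \<open>pres_eq X R\<close> is the
  monoid congruence on words generated by free cancellation and by \<open>l = r\<close> for \<open>(l, r)\<close>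
  in \<open>R\<close>; both entries of a pair are words.
\<close>

definition words :: "'a set \<Rightarrow> ('a \<times> bool) list set" where
  "words X = lists (X \<times> UNIV)"

inductive pres_eq ::
  "'a set \<Rightarrow> (('a \<times> bool) list \<times> ('a \<times> bool) list) set
     \<Rightarrow> ('a \<times> bool) list \<Rightarrow> ('a \<times> bool) list \<Rightarrow> bool"
  for X R where
  pres_refl: "w \<in> words X \<Longrightarrow> pres_eq X R w w"
| pres_sym: "pres_eq X R u v \<Longrightarrow> pres_eq X R v u"
| pres_trans: "pres_eq X R u v \<Longrightarrow> pres_eq X R v w \<Longrightarrow> pres_eq X R u w"
| pres_cong: "pres_eq X R u u' \<Longrightarrow> pres_eq X R v v' \<Longrightarrow> pres_eq X R (u @ v) (u' @ v')"
| pres_cancel: "x \<in> X \<Longrightarrow> pres_eq X R [(x, b), (x, \<not> b)] []"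
| pres_rel: "(l, r) \<in> R \<Longrightarrow> l \<in> words X \<Longrightarrow> r \<in> words X \<Longrightarrow> pres_eq X R l r"

definition pres_class ::
  "'a set \<Rightarrow> (('a \<times> bool) list \<times> ('a \<times> bool) list) set
     \<Rightarrow> ('a \<times> bool) list \<Rightarrow> ('a \<times> bool) list set" where
  "pres_class X R w = {v. pres_eq X R w v}"

definition presented_group ::
  "'a set \<Rightarrow> (('a \<times> bool) list \<times> ('a \<times> bool) list) set
     \<Rightarrow> ('a \<times> bool) list set monoid" where
  "presented_group X R =
     \<lparr> carrier = pres_class X R ` words X,
       mult = (\<lambda>A B. \<Union>u\<in>A. \<Union>v\<in>B. pres_class X R (u @ v)),
       one = pres_class X R [] \<rparr>"

lemma words_simps [simp]:
  "[] \<in> words X"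
  "a # w \<in> words X \<longleftrightarrow> fst a \<in> X \<and> w \<in> words X"
  "u @ v \<in> words X \<longleftrightarrow> u \<in> words X \<and> v \<in> words X"
  by (auto simp: words_def mem_Times_iff)

lemma pres_eq_words:
  "pres_eq X R u v \<Longrightarrow> u \<in> words X \<and> v \<in> words X"
  by (induction rule: pres_eq.induct) auto

lemma pres_class_eq_iff:
  assumes "u \<in> words X"
  shows "pres_class X R u = pres_class X R v \<longleftrightarrow> pres_eq X R u v"
  using assms unfolding pres_class_def
  by (auto intro: pres_refl pres_sym pres_trans)

lemma presented_group_mult:
  assumes "u \<in> words X" "v \<in> words X"
  shows "pres_class X R u \<otimes>\<^bsub>presented_group X R\<^esub> pres_class X R v = pres_class X R (u @ v)"
  using assms unfolding presented_group_def pres_class_def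
  by (auto intro: pres_refl pres_trans pres_cong)

lemma pres_eq_left_inverse:
  "w \<in> words X \<Longrightarrow> pres_eq X R (rev (map (\<lambda>(x, b). (x, \<not> b)) w) @ w) []"
proof (induction w)
  case Nil
  then show ?case by (simp add: pres_refl)
next
  case (Cons a w)
  obtain x b where a: "a = (x, b)" by (cases a)
  let ?w' = "rev (map (\<lambda>(x, b). (x, \<not> b)) w)"
  have x: "x \<in> X" and w: "w \<in> words X" using Cons.prems a by auto
  have w': "?w' \<in> words X" using pres_eq_words[OF Cons.IH[OF w]] by simp
  have "pres_eq X R [(x, \<not> b), (x, b)] []" using pres_cancel[OF x, of R "\<not> b"] by simp
  from pres_cong[OF pres_refl[OF w'] pres_cong[OF this pres_refl[OF w]]]
  have "pres_eq X R (?w' @ [(x, \<not> b), (x, b)] @ w) (?w' @ w)" by simp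
  then show ?case using pres_trans[OF _ Cons.IH[OF w]] a by simp
qed

lemma group_presented_group: "group (presented_group X R)"
proof (rule groupI)
  let ?G = "presented_group X R"
  have carr: "carrier ?G = pres_class X R ` words X" and one: "\<one>\<^bsub>?G\<^esub> = pres_class X R []"
    by (simp_all add: presented_group_def)
  show "\<one>\<^bsub>?G\<^esub> \<in> carrier ?G" by (simp add: carr one)
  show "\<And>x y. x \<in> carrier ?G \<Longrightarrow> y \<in> carrier ?G \<Longrightarrow> x \<otimes>\<^bsub>?G\<^esub> y \<in> carrier ?G"
    by (auto simp: carr presented_group_mult)
  show "\<And>x y z. x \<in> carrier ?G \<Longrightarrow> y \<in> carrier ?G \<Longrightarrow> z \<in> carrier ?G \<Longrightarrow>
      x \<otimes>\<^bsub>?G\<^esub> y \<otimes>\<^bsub>?G\<^esub> z = x \<otimes>\<^bsub>?G\<^esub> (y \<otimes>\<^bsub>?G\<^esub> z)"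
    by (auto simp: carr presented_group_mult)
  show "\<And>x. x \<in> carrier ?G \<Longrightarrow> \<one>\<^bsub>?G\<^esub> \<otimes>\<^bsub>?G\<^esub> x = x"
    by (auto simp: carr one presented_group_mult)
  show "\<exists>y\<in>carrier ?G. y \<otimes>\<^bsub>?G\<^esub> x = \<one>\<^bsub>?G\<^esub>" if x: "x \<in> carrier ?G" for x
  proof -
    obtain w where w: "w \<in> words X" "x = pres_class X R w" using x carr by auto
    let ?w' = "rev (map (\<lambda>(x, b). (x, \<not> b)) w)"
    have eq: "pres_eq X R (?w' @ w) []" by (rule pres_eq_left_inverse[OF w(1)])
    then have w': "?w' \<in> words X" using pres_eq_words by fastforce
    then have "pres_class X R ?w' \<otimes>\<^bsub>?G\<^esub> x = \<one>\<^bsub>?G\<^esub>"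
      using w eq by (simp add: presented_group_mult one pres_class_eq_iff)
    then show ?thesis using w' carr by blast
  qed
qed

text \<open>
  Artin's presentation of the braid group on \<open>n\<close> strands: generators \<open>1, \<dots>, n - 1\<close>, with
  \<open>i\<close> standing for the half twist of strands \<open>i\<close> and \<open>i + 1\<close>.
\<close>

definition braid_relations ::
  "nat \<Rightarrow> ((nat \<times> bool) list \<times> (nat \<times> bool) list) set" where
  "braid_relations n =
     {([(i, True), (j, True)], [(j, True), (i, True)]) | i j. 1 \<le> i \<and> i + 2 \<le> j \<and> j < n} \<union>
     {([(i, True), (i + 1, True), (i, True)], [(i + 1, True), (i, True), (i + 1, True)]) | i.
        1 \<le> i \<and> i + 1 < n}"

definition braid_group :: "nat \<Rightarrow> (nat \<times> bool) list set monoid" where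
  "braid_group n = presented_group {1..<n} (braid_relations n)"

definition braid_commutator_group :: "nat \<Rightarrow> (nat \<times> bool) list set monoid" where
  "braid_commutator_group n =
     (braid_group n)\<lparr>carrier := derived (braid_group n) (carrier (braid_group n))\<rparr>"

lemma group_braid_group: "group (braid_group n)"
  by (simp add: braid_group_def group_presented_group)

lemma group_braid_commutator_group: "group (braid_commutator_group n)"
proof -
  interpret group "braid_group n" by (rule group_braid_group)
  show ?thesis
    unfolding braid_commutator_group_def
    by (rule subgroup.subgroup_is_group[OF derived_is_subgroup is_group]) simp
qed

definition trivial_hom ::
  "('a, 'c) monoid_scheme \<Rightarrow> ('b, 'd) monoid_scheme \<Rightarrow> ('a \<Rightarrow> 'b) \<Rightarrow> bool" where
  "trivial_hom G H \<rho> \<longleftrightarrow> (\<forall>g\<in>carrier G. \<rho> g = \<one>\<^bsub>H\<^esub>)"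

text \<open>
  The locale \<^locale>\<open>transitive_action\<close> is about the library's group of bijections, whose elements
  are extensional on the set acted upon; permutations in \<^const>\<open>sym_group\<close> are the identity
  outside \<open>{1..n}\<close> instead, so transitivity is restated for them.
\<close>

definition transitive_hom ::
  "('a, 'c) monoid_scheme \<Rightarrow> nat \<Rightarrow> ('a \<Rightarrow> nat \<Rightarrow> nat) \<Rightarrow> bool" where
  "transitive_hom G n \<rho> \<longleftrightarrow> (\<forall>i\<in>{1..n}. \<forall>j\<in>{1..n}. \<exists>g\<in>carrier G. \<rho> g i = j)"

end

theory Submission
  imports Defs "HOL-Combinatorics.Orbits"
begin

text \<open>
  Write \<open>B\<close> for the braid group on \<open>n\<close> strands with half twists \<open>s\<^sub>1, \<dots>, s\<^sub>n\<^sub>-\<^sub>1\<close>, and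
  \<open>K\<close> for its commutator subgroup. Both claims follow from one fact: for \<open>n \<ge> 5\<close>, the group \<open>K\<close> acts
  trivially on every set \<open>X\<close> with fewer than \<open>n\<close> points. A subgroup of index \<open>r\<close> with
  \<open>2 \<le> r < n\<close> would give a transitive, hence nontrivial, action on its \<open>r\<close> cosets. If
  \<open>K \<rightarrow> S\<^sub>n\<close> is not transitive, then an orbit and its complement are both too small to carry a
  nontrivial action.

  Two observations carry the proof of this fact. The group \<open>K\<close> is perfect, so it acts by even
  permutations. Moreover, relations spread: if \<open>g \<in> K\<close> acts trivially and commutes with one
  generator \<open>s\<^sub>j\<close>, then all its conjugates in \<open>B\<close> are already conjugates under \<open>K\<close>, because
  \<open>B\<close> is \<open>K\<close> times the powers of \<open>s\<^sub>j\<close>; hence all of them act trivially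
  (\<open>core_if_commutes_with_generator\<close>). Let \<open>Q\<close>
  be the quotient of \<open>B\<close> by the elements of \<open>K\<close> all of whose conjugates act trivially. As soon as two
  adjacent generators agree in \<open>Q\<close>, all generators agree, \<open>Q\<close> is cyclic and \<open>K\<close> acts trivially. In
  particular it is enough that \<open>s\<^sub>i s\<^sub>j\<^sup>-\<^sup>1\<close> acts trivially for one suitable pair of generators.

  Five strands: \<open>S\<^sub>4\<close> is solvable, so a perfect group acts trivially on at most four points.

  Six strands: let \<open>a, b, c\<close> be the permutations given by \<open>s\<^sub>i s\<^sub>5\<^sup>-\<^sup>1\<close> for \<open>i = 1, 2, 3\<close>. The product
  \<open>b a c b\<close> exchanges \<open>a\<close> and \<open>c\<close>, so it commutes with \<open>a c\<close>, as \<open>a\<close> does. Centralizers of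
  nontrivial elements of \<open>A\<^sub>5\<close> are abelian (\<open>even_centralizer_commute\<close>). Hence either \<open>a c\<close> is nontrivial, \<open>a\<close> commutes with \<open>b a c b\<close>
  and \<open>a = c\<close>, or \<open>a c\<close> is trivial and \<open>s\<^sub>1 s\<^sub>3 = s\<^sub>5\<^sup>2\<close> holds in \<open>Q\<close>; that relation also forces
  two adjacent generators to coincide (\<open>generator_collapse_of_square_relation\<close>).

  Seven strands: an element of \<open>A\<^sub>6\<close> whose square is nontrivial has abelian centralizer. The element
  \<open>s\<^sub>1 s\<^sub>6\<^sup>-\<^sup>1\<close> commutes with \<open>s\<^sub>3 s\<^sub>6\<^sup>-\<^sup>1\<close> and \<open>s\<^sub>4 s\<^sub>6\<^sup>-\<^sup>1\<close>, and these two cannot commute with each other in a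
  nontrivial action: they satisfy the braid relation, so they would be equal. Therefore
  \<open>s\<^sub>1 s\<^sub>6\<^sup>-\<^sup>1\<close> acts as an involution. It follows that \<open>s\<^sub>1 s\<^sub>2\<^sup>-\<^sup>1\<close> acts with order three, so its centralizer is abelian.
  That centralizer contains the commutator subgroup of the braids on the last four strands, and if the latter
  acts commutatively, then \<open>s\<^sub>4\<close> and \<open>s\<^sub>6\<close> agree in \<open>Q\<close>.

  Eight or more strands: by induction the commutator subgroup \<open>K'\<close> for the first \<open>n - 3\<close> strands needs at
  least \<open>n - 3\<close> points to act on, so it moves at least that many points of \<open>X\<close>. A permutation
  commuting with \<open>K'\<close> fixes all these points: its nontrivial cycles are too few for \<open>K'\<close> to permute
  them nontrivially, and on each cycle \<open>K'\<close> acts through an abelian group, hence trivially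
  (\<open>commuting_permutation_support_disjoint\<close>). The element \<open>s\<^sub>n\<^sub>-\<^sub>2 s\<^sub>n\<^sub>-\<^sub>1\<^sup>-\<^sup>1\<close>
  commutes with \<open>K'\<close>, so it moves at most two points; being even, it acts trivially.
\<close>

section \<open>Commuting even permutations of few points\<close>

lemma sign_comp_permutes:
  assumes "finite X" "f permutes X" "g permutes X"
  shows "sign (f \<circ> g) = sign f * sign g"
  using assms by (meson permutation_permutes sign_compose)

lemma even_permutation_two_points:
  assumes "finite S" "card S \<le> 2" "f permutes S" "sign f = 1"
  shows "f = id"
proof -
  consider "S = {}" | x where "S = {x}" | x y where "x \<noteq> y" "S = {x, y}"
    using assms(1,2) by (metis card_0_eq card_1_singletonE card_2_iff le_SucE le_zero_eq numeral_2_eq_2 One_nat_def)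
  then show ?thesis
  proof cases
    case 3
    then show ?thesis using assms by (auto simp: permutes_doubleton_iff sign_swap_id)
  qed (use assms in auto)
qed

lemma even_permutation_three_points_fixing:
  assumes "finite S" "card S \<le> 3" "f permutes S" "sign f = 1" "p \<in> S" "f p = p"
  shows "f = id"
proof (rule even_permutation_two_points)
  show "f permutes (S - {p})"
    using assms by (intro permutes_superset[OF assms(3)]) auto
qed (use assms in auto)

lemma even_permutation_three_points_eqI:
  assumes "finite S" "card S \<le> 3" "f permutes S" "g permutes S" "sign f = 1" "sign g = 1"
    and "p \<in> S" "f p = g p"
  shows "f = g"
proof -
  have pf: "permutation f" using assms(1,3) permutation_permutes by blast
  have pi: "inv' f permutes S" using assms(3) by (rule permutes_inv)
  have "inv' f \<circ> g = id"
  proof (rule even_permutation_three_points_fixing[OF assms(1,2)])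
    show "inv' f \<circ> g permutes S" using pi assms(4) by (rule permutes_compose[rotated])
    show "sign (inv' f \<circ> g) = 1"
      using sign_comp_permutes[OF assms(1) pi assms(4)] sign_inverse[OF pf] assms(5,6) by simp
    show "(inv' f \<circ> g) p = p"
      using assms(3,8) by (metis comp_apply permutes_inverses(2))
  qed (rule assms)
  then have "f \<circ> (inv' f \<circ> g) = f" by simp
  then show ?thesis using permutes_inv_o(1)[OF assms(3)] by (simp add: o_assoc)
qed

lemma even_permutations_three_points_commute:
  assumes S: "finite S" "card S \<le> 3" and f: "f permutes S" "sign f = 1"
    and g: "g permutes S" "sign g = 1"
  shows "f \<circ> g = g \<circ> f"
proof (cases "f = id")
  case False
  then obtain p where p: "f p \<noteq> p" by (auto simp: fun_eq_iff)
  have pS: "p \<in> S" using p f permutes_not_in by metis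
  have inS: "f x \<in> S \<longleftrightarrow> x \<in> S" for x by (rule permutes_in_image[OF f(1)])
  have inj: "f x = f z \<longleftrightarrow> x = z" for x z using permutes_inj[OF f(1)] by (auto dest: injD)
  have ffp: "f (f p) \<noteq> p"
  proof
    assume e: "f (f p) = p"
    have "card (S - {p, f p}) \<le> 1"
      using S p pS inS by (simp add: card_Diff_subset)
    moreover have "f x \<in> S - {p, f p}" if "x \<in> S - {p, f p}" for x
      using that e inj[of x p] inj[of x "f p"] inS by auto
    ultimately have rest: "f x = x" if "x \<in> S - {p, f p}" for x
      using that S(1) card_le_Suc0_iff_eq[of "S - {p, f p}"]
      by (metis One_nat_def finite_Diff)
    have "f permutes {p, f p}"
      using rest by (intro permutes_superset[OF f(1)]) auto
    then have "f = id" using f(2) p by (intro even_permutation_two_points[of "{p, f p}"]) auto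
    then show False using p by simp
  qed
  have "{p, f p, f (f p)} = S"
    by (rule card_seteq) (use S p pS inS inj ffp in \<open>auto simp: card_insert_if\<close>)
  moreover have "g p \<in> S" using pS permutes_in_image[OF g(1)] by simp
  ultimately consider "g p = id p" | "g p = f p" | "g p = (f \<circ> f) p" by auto
  moreover have "f \<circ> f permutes S" using f by (intro permutes_compose)
  moreover have "sign (f \<circ> f) = 1" using sign_comp_permutes[OF S(1) f(1) f(1)] f by simp
  ultimately have "g = id \<or> g = f \<or> g = f \<circ> f"
    using even_permutation_three_points_eqI[OF S g(1) _ g(2) _ pS] f permutes_id by (metis sign_id)
  then show ?thesis by (auto simp: o_assoc)
qed simp

lemma sign_four_cycle:
  assumes "distinct [a, b, c, d]" "f permutes {a, b, c, d}" "f a = b" "f b = c" "f c = d" "f d = a"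
  shows "sign f = - 1"
proof -
  have "f = transpose a b \<circ> (transpose b c \<circ> transpose c d)"
  proof
    show "f x = (transpose a b \<circ> (transpose b c \<circ> transpose c d)) x" for x
      using assms permutes_not_in[OF assms(2), of x]
      by (cases "x \<in> {a, b, c, d}") (auto simp: transpose_def)
  qed
  then show ?thesis
    using assms(1) by (simp add: sign_compose permutation_compose permutation_swap_id sign_swap_id)
qed

lemma sign_three_swaps:
  assumes "distinct [a, b, c, a', b', c']" "f permutes {a, b, c, a', b', c'}"
    and "f a = a'" "f b = b'" "f c = c'" "f a' = a" "f b' = b" "f c' = c"
  shows "sign f = - 1"
proof -
  have "f = transpose a a' \<circ> (transpose b b' \<circ> transpose c c')"
  proof
    show "f x = (transpose a a' \<circ> (transpose b b' \<circ> transpose c c')) x" for x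
      using assms permutes_not_in[OF assms(2), of x]
      by (cases "x \<in> {a, b, c, a', b', c'}") (auto simp: transpose_def)
  qed
  then show ?thesis
    using assms(1) by (simp add: sign_compose permutation_compose permutation_swap_id sign_swap_id)
qed

lemma funpow_commute_apply:
  assumes "f \<circ> y = y \<circ> f"
  shows "f ((y ^^ i) x) = (y ^^ i) (f x)"
  by (induction i) (use assms in \<open>auto simp: fun_eq_iff\<close>)

text \<open>
  On the \<open>y\<close>-cycle of \<open>p\<close> both permutations agree with powers of \<open>y\<close>.
\<close>

lemma commute_on_cyclic_orbit:
  assumes "a \<circ> y = y \<circ> a" "b \<circ> y = y \<circ> b" "a p = (y ^^ i) p" "b p = (y ^^ j) p"
  shows "a (b p) = b (a p)"
proof -
  have "a (b p) = (y ^^ (j + i)) p" "b (a p) = (y ^^ (i + j)) p"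
    using assms(3,4) funpow_commute_apply[OF assms(1)] funpow_commute_apply[OF assms(2)]
    by (simp_all add: funpow_add)
  then show ?thesis by (simp add: add.commute)
qed

lemma permutes_funpow_return:
  assumes "finite X" "y permutes X"
  shows "\<exists>k. (y ^^ k) ((y ^^ j) x) = x"
proof (induction j)
  case 0
  show ?case by (intro exI[of _ 0]) simp
next
  case (Suc j)
  then obtain k where k: "(y ^^ k) ((y ^^ j) x) = x" by blast
  have "permutation y" using assms permutation_permutes by blast
  then have "(y ^^ j) x \<in> orbit y ((y ^^ j) x)" by (rule permutation_self_in_orbit)
  then obtain m where "0 < m" "(y ^^ m) ((y ^^ j) x) = (y ^^ j) x"
    unfolding orbit_altdef by force
  then obtain m' where "(y ^^ m') (y ((y ^^ j) x)) = (y ^^ j) x"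
    by (metis Suc_pred funpow_Suc_right o_apply)
  then have "(y ^^ (k + m')) ((y ^^ Suc j) x) = x"
    using k by (simp add: funpow_add)
  then show ?case ..
qed

text \<open>
  The image of \<open>p\<close> under \<open>a\<close> lies on a second \<open>y\<close>-cycle of the same length as that of \<open>p\<close>, so this
  length is at most three. If \<open>p\<close> is fixed by \<open>y\<close>, then \<open>a\<close> and \<open>b\<close> act on the at most three
  fixed points of \<open>y\<close>, where they induce even permutations up to a correction by powers of \<open>y\<close> elsewhere. If the length is two, then \<open>y\<close> is a double transposition, which the hypothesis allows only
  on five points; there all even permutations commuting with \<open>y\<close> are involutions. Length three is
  impossible, since a permutation that exchanges two 3-cycles is odd.
\<close>

lemma even_centralizer_commute_off_orbit:
  fixes X :: "'x set"
  assumes X: "finite X" "card X \<le> 6"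
    and y: "y permutes X" "sign y = 1" "y \<noteq> id"
    and small: "card X \<le> 5 \<or> y \<circ> y \<noteq> id"
    and a: "a permutes X" "sign a = 1" "a \<circ> y = y \<circ> a"
    and b: "b permutes X" "sign b = 1" "b \<circ> y = y \<circ> b"
    and off: "\<And>i. a p \<noteq> (y ^^ i) p"
  shows "a (b p) = b (a p)"
proof -
  define q where "q = a p"
  have injy: "y x = y z \<longleftrightarrow> x = z" for x z using permutes_inj[OF y(1)] by (auto dest: injD)
  have inja: "a x = a z \<longleftrightarrow> x = z" for x z using permutes_inj[OF a(1)] by (auto dest: injD)
  have injb: "b x = b z \<longleftrightarrow> x = z" for x z using permutes_inj[OF b(1)] by (auto dest: injD)
  have inX: "y x \<in> X \<longleftrightarrow> x \<in> X" "a x \<in> X \<longleftrightarrow> x \<in> X" "b x \<in> X \<longleftrightarrow> x \<in> X" for x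
    using permutes_in_image[OF y(1)] permutes_in_image[OF a(1)] permutes_in_image[OF b(1)] by auto
  have ay: "a (y x) = y (a x)" for x
    using a(3) by (auto simp: fun_eq_iff)
  have yq: "y q = a (y p)" using ay q_def by simp
  have "p \<in> X"
    using off[of 0] permutes_not_in[OF a(1)] by force
  then have pq: "p \<in> X" "q \<in> X" using inX q_def by auto
  have apart: "(y ^^ j) q \<noteq> (y ^^ i) p" for i j
  proof
    assume e: "(y ^^ j) q = (y ^^ i) p"
    obtain k where "(y ^^ k) ((y ^^ j) q) = q" using permutes_funpow_return[OF X(1) y(1)] by blast
    then have "q = (y ^^ (k + i)) p" using e by (simp add: funpow_add)
    then show False using off q_def by simp
  qed
  have ap: "q \<noteq> p" "q \<noteq> y p" "q \<noteq> y (y p)" "y q \<noteq> p" "y q \<noteq> y p" "y q \<noteq> y (y p)"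
    "y (y q) \<noteq> p" "y (y q) \<noteq> y p" "y (y q) \<noteq> y (y p)"
    using apart[of 0 0] apart[of 0 1] apart[of 0 2] apart[of 1 0] apart[of 1 1] apart[of 1 2]
      apart[of 2 0] apart[of 2 1] apart[of 2 2]
    by (auto simp: numeral_2_eq_2)
  consider (one) "y p = p" | (two) "y p \<noteq> p" "y (y p) = p" | (three) "y p \<noteq> p" "y (y p) \<noteq> p"
    by blast
  then show ?thesis
  proof cases
    case one
    define F where "F = {x \<in> X. y x = x}"
    define M where "M = {x \<in> X. y x \<noteq> x}"
    have XFM: "X = F \<union> M" "F \<inter> M = {}" "finite F" "finite M" using X by (auto simp: F_def M_def)
    have yM: "y permutes M"
      by (rule permutes_superset[OF y(1)]) (auto simp: M_def)
    have cM: "card M \<ge> 3"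
      using even_permutation_two_points[OF XFM(4) _ yM y(2)] y(3) by force
    have cX: "card X = card F + card M" using XFM card_Un_disjoint by metis
    have pF: "p \<in> F" "q \<in> F" using one pq yq by (auto simp: F_def q_def)
    have Finv: "f x \<in> F \<longleftrightarrow> x \<in> F" if "f permutes X" "f \<circ> y = y \<circ> f" for f x
    proof -
      have "y (f x) = f (y x)" using that(2) by (auto simp: fun_eq_iff)
      then show ?thesis using permutes_in_image[OF that(1)] permutes_inj[OF that(1)]
        by (auto simp: F_def dest: injD)
    qed
    show ?thesis
    proof (cases "F = {p, q}")
      case True
      have "a q = p" using Finv[OF a(1,3), of q] pF True inja q_def by auto
      moreover have "b p \<in> {p, q}" "b q \<in> {p, q}"
        using Finv[OF b(1,3)] pF True by auto
      ultimately show ?thesis using injb[of p q] ap(1) q_def by auto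
    next
      case False
      have "{p, q} \<subset> F" using False pF by auto
      then have "card {p, q} < card F" using XFM(3) psubset_card_mono by blast
      then have cF: "card F \<ge> 3" using ap(1) by simp
      then have c3: "card F = 3" "card M = 3" using cM cX X by auto
      obtain m where m: "m \<in> M" using c3 by fastforce
      have ym: "y m \<in> M" "y (y m) \<in> M" using m permutes_in_image[OF yM] by auto
      have yym: "y (y m) \<noteq> m"
      proof
        assume e: "y (y m) = m"
        have "card (M - {m, y m}) = 1"
          using c3 m ym XFM(4) by (subst card_Diff_subset) (auto simp: M_def)
        then obtain r where r: "M - {m, y m} = {r}" by (auto simp: card_1_singleton_iff)
        then have "r \<in> M" "y r \<in> M" "y r \<noteq> r" using permutes_in_image[OF yM] by (auto simp: M_def)
        then show False using r e injy by (metis DiffI insertE singletonD DiffD2 insertI1 insertI2 singletonI)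
      qed
      have Meq: "M = {m, y m, y (y m)}"
        by (rule card_seteq[symmetric]) (use c3 m ym yym injy XFM(4) in \<open>auto simp: M_def\<close>)
      have power: "\<exists>g. g permutes F \<and> sign g = 1 \<and> (\<forall>x\<in>F. g x = f x)"
        if f: "f permutes X" "sign f = 1" "f \<circ> y = y \<circ> f" for f
      proof -
        have "f m \<in> M" using Finv[OF f(1,3), of m] permutes_in_image[OF f(1), of m] m XFM by auto
        then have "\<exists>i\<in>{0,1,2}. f m = (y ^^ i) m" using Meq by (auto simp: numeral_2_eq_2)
        then obtain i where i: "f m = (y ^^ i) m" by blast
        define w where "w = y ^^ i"
        have w: "w permutes X" unfolding w_def using y(1) by (rule permutes_funpow)
        have sw: "sign w = 1" unfolding w_def
          by (induction i) (simp_all only: funpow.simps sign_id y(2) mult_1_left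
              sign_comp_permutes[OF X(1) y(1) permutes_funpow[OF y(1)]])
        have wi: "inv' w permutes X" using w by (rule permutes_inv)
        have swi: "sign (inv' w) = 1" using sw sign_inverse w X permutation_permutes by metis
        define g where "g = inv' w \<circ> f"
        have fw: "f x = w x" if "x \<in> M" for x
        proof -
          have "x = (y ^^ 0) m \<or> x = (y ^^ 1) m \<or> x = (y ^^ 2) m"
            using that Meq by (auto simp: numeral_2_eq_2)
          then obtain j where j: "x = (y ^^ j) m" by blast
          have "f x = (y ^^ (j + i)) m"
            using funpow_commute_apply[OF f(3), of j m] i j by (simp add: funpow_add)
          also have "\<dots> = w x" unfolding j w_def by (simp add: funpow_add add.commute[of j])
          finally show ?thesis .
        qed
        have "g permutes F"
        proof (rule permutes_superset)
          show "g permutes X" unfolding g_def using f(1) wi by (rule permutes_compose)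
          show "\<And>x. x \<in> X - F \<Longrightarrow> g x = x"
            using fw XFM w by (auto simp: g_def permutes_inverses)
        qed
        moreover have "sign g = 1"
          unfolding g_def using sign_comp_permutes[OF X(1) wi f(1)] swi f(2) by simp
        moreover have "g x = f x" if "x \<in> F" for x
        proof -
          have "w z = z" if "z \<in> F" for z unfolding w_def
            using that by (induction i) (auto simp: F_def)
          then have "w (f x) = f x" using Finv[OF f(1,3)] that by simp
          then show ?thesis unfolding g_def using w by (simp add: permutes_inv_eq)
        qed
        ultimately show ?thesis by blast
      qed
      obtain a' where a': "a' permutes F" "sign a' = 1" "\<forall>x\<in>F. a' x = a x"
        using power[OF a] by (elim exE conjE)
      obtain b' where b': "b' permutes F" "sign b' = 1" "\<forall>x\<in>F. b' x = b x"
        using power[OF b] by (elim exE conjE)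
      have "a' \<circ> b' = b' \<circ> a'"
        using even_permutations_three_points_commute[OF XFM(3) _ a'(1,2) b'(1,2)] c3 by simp
      then have "a' (b' p) = b' (a' p)" by (auto simp: fun_eq_iff)
      moreover have "a p \<in> F" "b p \<in> F" using Finv[OF a(1,3)] Finv[OF b(1,3)] pF by auto
      ultimately show ?thesis using a'(3) b'(3) pF by simp
    qed
  next
    case two
    have q2: "y q \<noteq> q" "y (y q) = q" unfolding q_def ay[symmetric] inja using two by auto
    define W where "W = {p, y p, q, y q}"
    have WX: "W \<subseteq> X" using pq inX by (auto simp: W_def)
    have cW: "card W = 4" using two q2 ap by (auto simp: W_def)
    have WW: "y x \<in> W \<longleftrightarrow> x \<in> W" for x using two q2 injy by (auto simp: W_def)
    have yyW: "y (y x) = x" if "x \<in> W" for x using that two q2 by (auto simp: W_def)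
    have yW: "y x \<noteq> x" if "x \<in> W" for x using that two q2 by (auto simp: W_def)
    have cR: "card (X - W) = card X - 4" "finite (X - W)"
      using cW WX X by (auto simp: card_Diff_subset finite_subset)
    \<comment> \<open>The even permutation that remains of y after its two known transpositions moves at most two points.\<close>
    define z where "z = transpose p (y p) \<circ> (transpose q (y q) \<circ> y)"
    have "z = id"
    proof (rule even_permutation_two_points)
      have "z permutes X" unfolding z_def using pq inX y(1)
        by (intro permutes_compose permutes_swap_id) auto
      moreover have "z x = x" if "x \<in> X - (X - W)" for x
        using that WX two q2 ap by (auto simp: z_def W_def transpose_def)
      ultimately show "z permutes (X - W)" by (rule permutes_superset) 
      have "permutation y" using X y permutation_permutes by blast
      then show "sign z = 1" unfolding z_def using two q2 y(2)
        by (simp add: sign_compose permutation_compose permutation_swap_id sign_swap_id)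
    qed (use cR X in auto)
    then have "transpose q (y q) \<circ> y = transpose p (y p)"
      unfolding z_def by (metis comp_id fun.map_id0 o_assoc transpose_comp_involutory)
    then have y_eq: "y = transpose q (y q) \<circ> transpose p (y p)"
      by (metis comp_id id_comp o_assoc transpose_comp_involutory)
    have fixR: "y x = x" if "x \<notin> W" for x
      by (subst y_eq) (use that in \<open>auto simp: W_def transpose_def\<close>)
    have "y \<circ> y = id"
      using yyW fixR by (auto simp: fun_eq_iff) metis
    then have "card X \<le> 5" using small by blast
    then have cR1: "card (X - W) \<le> 1" using cR by simp
    have invol: "f \<circ> f = id" if f: "f permutes X" "sign f = 1" "f \<circ> y = y \<circ> f" for f
    proof -
      have fy: "f (y x) = y (f x)" for x using f(3) by (auto simp: fun_eq_iff)
      have injf: "f x = f u \<longleftrightarrow> x = u" for x u using permutes_inj[OF f(1)] by (auto dest: injD)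
      have fW: "f x \<in> W \<longleftrightarrow> x \<in> W" for x
        using fy fixR yW injf by metis
      have off: "f x = x" if "x \<notin> W" for x
      proof (cases "x \<in> X")
        case True
        then have "x \<in> X - W" "f x \<in> X - W"
          using that fW permutes_in_image[OF f(1)] by auto
        then show ?thesis using cR1 cR(2) card_le_Suc0_iff_eq by (metis One_nat_def)
      qed (use f permutes_not_in in metis)
      \<comment> \<open>If f were not an involution, it would be a 4-cycle on W, hence odd.\<close>
      have fpW: "f permutes W" using off by (intro permutes_superset[OF f(1)]) auto
      have ffp: "f (f x) = x" if x: "x \<in> W" for x
      proof (rule ccontr)
        assume ne: "f (f x) \<noteq> x"
        define u where "u = f x"
        have u: "u \<in> W" using fW x u_def by simp
        have "u \<noteq> x" using ne u_def by auto
        have "u \<noteq> y x" using ne fy yyW[OF x] u_def by metis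
        have D: "distinct [x, u, y x, y u]" 
          using \<open>u \<noteq> x\<close> \<open>u \<noteq> y x\<close> yW[OF x] yW[OF u] injy yyW[OF x] yyW[OF u] by auto
        have WD: "W = {x, u, y x, y u}"
          by (rule card_seteq[symmetric]) (use x u WW cW D in \<open>auto simp: W_def\<close>)
        have fu: "f u \<in> W" "f u \<noteq> u" "f u \<noteq> y u" "f u \<noteq> x"
          using fW u \<open>u \<noteq> x\<close> \<open>u \<noteq> y x\<close> injf u_def ne fy by metis+
        then have "f u = y x" using WD by auto
        then have "sign f = - 1"
          using fy yyW[OF x] u_def D fpW WD by (intro sign_four_cycle[of x u "y x" "y u"]) auto
        then show False using f(2) by simp
      qed
      show ?thesis
      proof
        show "(f \<circ> f) x = id x" for x using off ffp by (cases "x \<in> W") auto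
      qed
    qed
    have ab: "(a \<circ> b) \<circ> (a \<circ> b) = id"
    proof (rule invol)
      show "a \<circ> b permutes X" using b(1) a(1) by (rule permutes_compose)
      show "sign (a \<circ> b) = 1" using sign_comp_permutes[OF X(1) a(1) b(1)] a b by simp
      show "a \<circ> b \<circ> y = y \<circ> (a \<circ> b)" using a(3) b(3) by (metis o_assoc)
    qed
    have aa: "a (a x) = x" and bb: "b (b x) = x" and abab: "a (b (a (b x))) = x" for x
      using invol[OF a] invol[OF b] ab by (auto simp: fun_eq_iff)
    show ?thesis using aa bb abab by metis
  next
    case three
    define S where "S = {p, y p, y (y p), q, y q, y (y q)}"
    have q3: "y q \<noteq> q" "y (y q) \<noteq> q" unfolding q_def ay[symmetric] inja using three by auto
    have D: "distinct [p, y p, y (y p), q, y q, y (y q)]"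
      using three q3 ap injy by auto
    have SX: "S = X"
      by (rule card_seteq) (use D X pq inX in \<open>auto simp: S_def\<close>)
    have "y (y (y p)) \<in> S" using SX pq inX by simp
    then have y3: "y (y (y p)) = p"
      using D injy apart[of 0 3] apart[of 1 3] apart[of 2 3]
      by (auto simp: S_def numeral_3_eq_3 numeral_2_eq_2)
    have "a q \<in> S" using SX pq inX by simp
    moreover have "a q \<noteq> q" "a q \<noteq> y q" "a q \<noteq> y (y q)"
      using inja ap ay yq q_def by metis+
    ultimately have "a q \<in> {p, y p, y (y p)}" by (auto simp: S_def)
    then consider "a q = p" | "a q = y p" | "a q = y (y p)" by blast
    \<comment> \<open>The cube of a is used because it exchanges the two cycles by an honest involution.\<close>
    then obtain q' where q': "a (a (a p)) = q'" "a (a (a q')) = p" "q' \<in> {q, y q, y (y q)}"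
      by cases (use q_def ay y3 yq in auto)
    have D': "distinct [p, y p, y (y p), q', y q', y (y q')]"
      "{p, y p, y (y p), q', y q', y (y q')} = X"
    proof -
      have "y (y (y q)) = q" using y3 ay q_def by metis
      then have "{q', y q', y (y q')} = {q, y q, y (y q)}"
        "distinct [q', y q', y (y q')]" using q'(3) D by auto
      then show "distinct [p, y p, y (y p), q', y q', y (y q')]"
        "{p, y p, y (y p), q', y q', y (y q')} = X" using D SX by (auto simp: S_def)
    qed
    have a3: "a \<circ> (a \<circ> a) permutes {p, y p, y (y p), q', y q', y (y q')}"
      unfolding D' using a(1) by (intro permutes_compose)
    have "sign (a \<circ> (a \<circ> a)) = - 1"
      using ay q' by (intro sign_three_swaps[OF D'(1) a3]) auto
    moreover have "sign (a \<circ> (a \<circ> a)) = 1"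
      using sign_comp_permutes[OF X(1) a(1) a(1)] a(2)
        sign_comp_permutes[OF X(1) a(1) permutes_compose[OF a(1) a(1)]] by simp
    ultimately show ?thesis by simp
  qed
qed

text \<open>
  In \<open>A\<^sub>k\<close> with \<open>k \<le> 5\<close> the centralizer of every nontrivial element is abelian. In \<open>A\<^sub>6\<close> this
  fails only for double transpositions, whose centralizer is dihedral of order eight.
\<close>

lemma even_centralizer_commute:
  fixes X :: "'x set"
  assumes X: "finite X" "card X \<le> 6"
    and y: "y permutes X" "sign y = 1" "y \<noteq> id" "card X \<le> 5 \<or> y \<circ> y \<noteq> id"
    and a: "a permutes X" "sign a = 1" "a \<circ> y = y \<circ> a"
    and b: "b permutes X" "sign b = 1" "b \<circ> y = y \<circ> b"
  shows "a \<circ> b = b \<circ> a"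
proof
  fix p
  show "(a \<circ> b) p = (b \<circ> a) p"
    using even_centralizer_commute_off_orbit[OF X y a b, of p]
      even_centralizer_commute_off_orbit[OF X y b a, of p]
      commute_on_cyclic_orbit[OF a(3) b(3), of p]
    by fastforce
qed

section \<open>Permutation actions of perfect groups\<close>

text \<open>
  Actions are kept as genuine permutations, which are the identity outside \<open>X\<close>, so that they
  compose as functions and have a sign.
\<close>

locale perm_rep = group K for K (structure) +
  fixes \<phi> :: "'a \<Rightarrow> 'x \<Rightarrow> 'x" and X :: "'x set"
  assumes finite: "finite X"
    and permutes: "g \<in> carrier K \<Longrightarrow> \<phi> g permutes X"
    and mult: "g \<in> carrier K \<Longrightarrow> h \<in> carrier K \<Longrightarrow> \<phi> (g \<otimes> h) = \<phi> g \<circ> \<phi> h"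
begin

lemma one: "\<phi> \<one> = id"
proof
  fix x
  have "\<phi> \<one> (\<phi> \<one> x) = \<phi> \<one> x" using mult[of \<one> \<one>] by (metis comp_apply one_closed r_one)
  then show "\<phi> \<one> x = id x" using permutes_inj[OF permutes[OF one_closed]] by (auto dest: injD)
qed

lemma inv_left: "g \<in> carrier K \<Longrightarrow> \<phi> (inv g) (\<phi> g x) = x"
  and inv_right: "g \<in> carrier K \<Longrightarrow> \<phi> g (\<phi> (inv g) x) = x"
  using mult[of "inv g" g] mult[of g "inv g"] one by (auto simp: fun_eq_iff)

lemma in_image: "g \<in> carrier K \<Longrightarrow> \<phi> g x \<in> X \<longleftrightarrow> x \<in> X"
  using permutes permutes_in_image by metis

lemma inj: "g \<in> carrier K \<Longrightarrow> \<phi> g x = \<phi> g y \<longleftrightarrow> x = y"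
  using permutes permutes_inj by (metis injD)

lemma sign_mult:
  "g \<in> carrier K \<Longrightarrow> h \<in> carrier K \<Longrightarrow> sign (\<phi> (g \<otimes> h)) = sign (\<phi> g) * sign (\<phi> h)"
  using mult sign_comp_permutes[OF finite] permutes by simp

end

lemma perm_rep_of_action:
  assumes "group K" "finite Y"
    and closed: "\<And>g y. g \<in> carrier K \<Longrightarrow> y \<in> Y \<Longrightarrow> \<psi> g y \<in> Y"
    and one: "\<And>y. y \<in> Y \<Longrightarrow> \<psi> \<one>\<^bsub>K\<^esub> y = y"
    and mult: "\<And>g h y. g \<in> carrier K \<Longrightarrow> h \<in> carrier K \<Longrightarrow> y \<in> Y \<Longrightarrow> \<psi> (g \<otimes>\<^bsub>K\<^esub> h) y = \<psi> g (\<psi> h y)"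
  shows "perm_rep K (\<lambda>g y. if y \<in> Y then \<psi> g y else y) Y"
proof -
  interpret group K by fact
  show ?thesis
  proof
    fix g assume g: "g \<in> carrier K"
    have "bij_betw (\<psi> g) Y Y"
      by (rule bij_betw_byWitness[where f' = "\<psi> (inv\<^bsub>K\<^esub> g)"])
        (use g closed one mult[symmetric] in auto)
    then have "bij_betw (\<lambda>y. if y \<in> Y then \<psi> g y else y) Y Y" by (simp cong: bij_betw_cong)
    then show "(\<lambda>y. if y \<in> Y then \<psi> g y else y) permutes Y" by (rule bij_imp_permutes) simp
  next
    fix g h assume "g \<in> carrier K" "h \<in> carrier K"
    then show "(\<lambda>y. if y \<in> Y then \<psi> (g \<otimes>\<^bsub>K\<^esub> h) y else y) =
        (\<lambda>y. if y \<in> Y then \<psi> g y else y) \<circ> (\<lambda>y. if y \<in> Y then \<psi> h y else y)"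
      using closed mult by auto
  qed (use assms in auto)
qed

definition perfect :: "('a, 'c) monoid_scheme \<Rightarrow> bool" where
  "perfect G \<longleftrightarrow> derived G (carrier G) = carrier G"

lemma (in group) perfect_subset_subgroup:
  assumes "perfect G" "subgroup S G"
    and "\<And>g h. g \<in> carrier G \<Longrightarrow> h \<in> carrier G \<Longrightarrow> g \<otimes> h \<otimes> inv g \<otimes> inv h \<in> S"
  shows "carrier G \<subseteq> S"
proof -
  have "derived G (carrier G) \<subseteq> S"
    unfolding derived_def by (rule generate_subgroup_incl) (use assms in auto)
  then show ?thesis using assms(1) by (simp add: perfect_def)
qed

context perm_rep
begin

lemma perfect_even:
  assumes "perfect K" "g \<in> carrier K"
  shows "sign (\<phi> g) = 1"
proof -
  have sq: "sign (\<phi> g) * sign (\<phi> (inv g)) = 1" if "g \<in> carrier K" for g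
    using sign_mult[of g "inv g"] one that by simp
  have "carrier K \<subseteq> {g \<in> carrier K. sign (\<phi> g) = 1}"
  proof (rule perfect_subset_subgroup[OF assms(1)])
    show "subgroup {g \<in> carrier K. sign (\<phi> g) = 1} K"
      by (rule subgroupI) (use one sq sign_mult in fastforce)+
    show "g \<otimes> h \<otimes> inv g \<otimes> inv h \<in> {g \<in> carrier K. sign (\<phi> g) = 1}"
      if gh: "g \<in> carrier K" "h \<in> carrier K" for g h
    proof -
      have "sign (\<phi> (g \<otimes> h \<otimes> inv g \<otimes> inv h)) =
          (sign (\<phi> g) * sign (\<phi> (inv g))) * (sign (\<phi> h) * sign (\<phi> (inv h)))"
        using gh by (simp add: sign_mult ac_simps)
      then show ?thesis using gh sq by simp
    qed
  qed
  then show ?thesis using assms(2) by blast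
qed

text \<open>
  A perfect group has no nontrivial abelian quotient. The statement is local to an invariant set on which
  the group acts commutatively.
\<close>

lemma perfect_fixes_if_commuting:
  assumes "perfect K"
    and inv: "\<And>g x. g \<in> carrier K \<Longrightarrow> x \<in> Y \<Longrightarrow> \<phi> g x \<in> Y"
    and comm: "\<And>g h x. g \<in> carrier K \<Longrightarrow> h \<in> carrier K \<Longrightarrow> x \<in> Y \<Longrightarrow> \<phi> g (\<phi> h x) = \<phi> h (\<phi> g x)"
    and "g \<in> carrier K" "x \<in> Y"
  shows "\<phi> g x = x"
proof -
  have "carrier K \<subseteq> {g \<in> carrier K. \<phi> g x = x}"
  proof (rule perfect_subset_subgroup[OF assms(1)])
    show "subgroup {g \<in> carrier K. \<phi> g x = x} K"
      by (rule subgroupI) (use one mult inv_left in \<open>auto simp: fun_eq_iff\<close>, metis)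
    show "g \<otimes> h \<otimes> inv g \<otimes> inv h \<in> {g \<in> carrier K. \<phi> g x = x}"
      if gh: "g \<in> carrier K" "h \<in> carrier K" for g h
    proof -
      let ?y = "\<phi> (inv g) (\<phi> (inv h) x)"
      have "?y \<in> Y" using inv gh assms(5) by simp
      then have "\<phi> g (\<phi> h ?y) = \<phi> h (\<phi> g ?y)" using comm gh by simp
      also have "\<dots> = x" using inv_right gh by simp
      finally show ?thesis using gh by (simp add: mult)
    qed
  qed
  then show ?thesis using assms(4) by blast
qed

lemma perfect_trivial_if_commuting:
  assumes "perfect K"
    and "\<And>g h. g \<in> carrier K \<Longrightarrow> h \<in> carrier K \<Longrightarrow> \<phi> g \<circ> \<phi> h = \<phi> h \<circ> \<phi> g"
    and "g \<in> carrier K"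
  shows "\<phi> g = id"
  using perfect_fixes_if_commuting[OF assms(1), of UNIV g] assms(2,3)
  by (auto simp: fun_eq_iff)

lemma perfect_trivial_on_three_points:
  assumes "perfect K" "card X \<le> 3" "g \<in> carrier K"
  shows "\<phi> g = id"
  using perfect_trivial_if_commuting[OF assms(1) _ assms(3)]
    even_permutations_three_points_commute[OF finite assms(2)] permutes perfect_even[OF assms(1)]
  by blast

end

text \<open>
  The solvable series of \<open>S\<^sub>4\<close> in terms of actions: four points have three partitions into two pairs, so
  the group fixes each partition. A permutation fixing all three partitions is an involution, and a
  group of involutions is commutative.
\<close>

lemma (in perm_rep) perfect_trivial_on_four_points:
  assumes perf: "perfect K" and card4: "card X \<le> 4" and g: "g \<in> carrier K"
  shows "\<phi> g = id"
proof (cases "card X \<le> 3")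
  case False
  then have c4: "card X = 4" using card4 by simp
  define P where "P = (\<lambda>A. {A, X - A}) ` {A. A \<subseteq> X \<and> card A = 2}"
  have finP: "finite P" using finite by (simp add: P_def)
  obtain a where a: "a \<in> X" using c4 by fastforce
  have "P \<subseteq> (\<lambda>x. {{a, x}, X - {a, x}}) ` (X - {a})"
  proof
    fix p assume "p \<in> P"
    then obtain A where A: "A \<subseteq> X" "card A = 2" and p: "p = {A, X - A}" by (auto simp: P_def)
    define C where "C = (if a \<in> A then A else X - A)"
    have C: "C \<subseteq> X" "a \<in> C" "p = {C, X - C}" using A a p by (auto simp: C_def double_diff)
    have "card C = 2" using A c4 finite by (auto simp: C_def card_Diff_subset finite_subset)
    then obtain x where x: "C = {a, x}" "x \<noteq> a" using C(2) by (auto simp: card_2_iff)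
    then show "p \<in> (\<lambda>x. {{a, x}, X - {a, x}}) ` (X - {a})" using C by auto
  qed
  then have "card P \<le> card (X - {a})" using finite by (meson finite_Diff surj_card_le)
  then have cP: "card P \<le> 3" using c4 a by simp
  define \<psi> where "\<psi> = (\<lambda>g. (`) ((`) (\<phi> g)))"
  have img: "\<phi> g ` X = X" if "g \<in> carrier K" for g using permutes[OF that] by (rule permutes_image)
  have \<psi>: "perm_rep K (\<lambda>g y. if y \<in> P then \<psi> g y else y) P"
  proof (rule perm_rep_of_action[OF group_axioms finP])
    fix g y assume gy: "g \<in> carrier K" "y \<in> P"
    then obtain A where A: "A \<subseteq> X" "card A = 2" "y = {A, X - A}" by (auto simp: P_def)
    have ij: "inj (\<phi> g)" using permutes[OF gy(1)] by (rule permutes_inj)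
    have "\<phi> g ` A \<subseteq> X" "card (\<phi> g ` A) = 2" "\<phi> g ` (X - A) = X - \<phi> g ` A"
      using A img[OF gy(1)] ij by (auto simp: card_image inj_on_subset image_set_diff)
    then show "\<psi> g y \<in> P" unfolding P_def \<psi>_def using A(3) by auto
  qed (simp_all add: \<psi>_def one mult image_comp comp_def image_image)
  interpret P: perm_rep K "\<lambda>g y. if y \<in> P then \<psi> g y else y" P by (rule \<psi>)
  have pres: "\<phi> g ` A \<in> {A, X - A}" if "g \<in> carrier K" "A \<subseteq> X" "card A = 2" for g A
  proof -
    have "{A, X - A} \<in> P" using that by (auto simp: P_def)
    moreover from this have "\<psi> g {A, X - A} = {A, X - A}"
      using P.perfect_trivial_on_three_points[OF perf cP that(1)] by (auto simp: fun_eq_iff split: if_splits)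
    ultimately show ?thesis by (auto simp: \<psi>_def)
  qed
  have invol: "\<phi> g (\<phi> g x) = x" if g: "g \<in> carrier K" for g x
  proof (cases "\<phi> g x = x")
    case False
    then have x: "x \<in> X" using permutes[OF g] permutes_not_in by metis
    have y: "\<phi> g x \<in> X" using x in_image g by simp
    have "\<phi> g ` {x, \<phi> g x} \<in> {{x, \<phi> g x}, X - {x, \<phi> g x}}"
      by (rule pres[OF g]) (use x y False in auto)
    then have "\<phi> g (\<phi> g x) \<in> {x, \<phi> g x}" by blast
    then show ?thesis using False inj[OF g] by auto
  qed simp
  have "\<phi> g \<circ> \<phi> h = \<phi> h \<circ> \<phi> g" if "g \<in> carrier K" "h \<in> carrier K" for g h
  proof
    fix x
    have "\<phi> (g \<otimes> h) (\<phi> (g \<otimes> h) y) = y" for y using invol that by simp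
    then have "\<phi> g (\<phi> h (\<phi> g (\<phi> h y))) = y" for y using that by (simp add: mult)
    then show "(\<phi> g \<circ> \<phi> h) x = (\<phi> h \<circ> \<phi> g) x"
      using invol[OF that(1)] invol[OF that(2)] by (metis comp_apply)
  qed
  then show ?thesis using perfect_trivial_if_commuting[OF perf _ g] by blast
qed (use perfect_trivial_on_three_points[OF perf _ g] in blast)

text \<open>
  The property quantifies over subsets of \<open>nat\<close> only, which makes it a single predicate that can serve as an
  induction hypothesis; it transfers to finite sets of any type.
\<close>

definition acts_trivially_below :: "('a, 'c) monoid_scheme \<Rightarrow> nat \<Rightarrow> bool" where
  "acts_trivially_below G m \<longleftrightarrow>
     (\<forall>\<phi> (X :: nat set). perm_rep G \<phi> X \<and> card X < m \<longrightarrow> (\<forall>g\<in>carrier G. \<phi> g = id))"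

lemma (in perm_rep) trivial_if_acts_trivially_below:
  assumes "acts_trivially_below K m" "card X < m" "g \<in> carrier K"
  shows "\<phi> g = id"
proof -
  obtain f where f: "bij_betw f X {0..<card X}" using ex_bij_betw_finite_nat[OF finite] by blast
  define k where "k = inv_into X f"
  have k: "k i \<in> X" "f (k i) = i" if "i \<in> {0..<card X}" for i
    using f that bij_betw_inv_into[OF f] bij_betw_inv_into_right[OF f]
    by (auto simp: k_def bij_betw_def)
  have kf: "k (f x) = x" if "x \<in> X" for x using f that by (simp add: k_def bij_betw_inv_into_left)
  have fX: "f x \<in> {0..<card X}" if "x \<in> X" for x using f that by (rule bij_betwE[THEN bspec])
  let ?\<psi> = "\<lambda>g i. if i \<in> {0..<card X} then f (\<phi> g (k i)) else i"
  have "perm_rep K ?\<psi> {0..<card X}"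
    by (rule perm_rep_of_action[OF group_axioms])
      (use k kf fX in_image in \<open>auto simp: one mult simp del: atLeastLessThan_iff\<close>)
  moreover have "card {0..<card X} < m" using assms(2) by simp
  ultimately have triv: "?\<psi> g = id" using assms(1,3) unfolding acts_trivially_below_def by blast
  show ?thesis
  proof
    fix x
    show "\<phi> g x = id x"
    proof (cases "x \<in> X")
      case True
      then have "f (\<phi> g x) = f x" using fun_cong[OF triv, of "f x"] fX kf by (simp del: atLeastLessThan_iff)
      then have "k (f (\<phi> g x)) = k (f x)" by simp
      then show ?thesis using kf in_image[OF assms(3)] True by simp
    qed (use permutes[OF assms(3)] permutes_not_in in fastforce)
  qed
qed

lemma (in perm_rep) perm_rep_restrict:
  assumes "Y \<subseteq> X" "\<And>g y. g \<in> carrier K \<Longrightarrow> y \<in> Y \<Longrightarrow> \<phi> g y \<in> Y"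
  shows "perm_rep K (\<lambda>g y. if y \<in> Y then \<phi> g y else y) Y"
  by (rule perm_rep_of_action[OF group_axioms])
    (use assms finite finite_subset in \<open>auto simp: one mult\<close>)

lemma (in perm_rep) fixes_invariant_subset:
  assumes "acts_trivially_below K m" "Y \<subseteq> X" "card Y < m"
    and "\<And>g y. g \<in> carrier K \<Longrightarrow> y \<in> Y \<Longrightarrow> \<phi> g y \<in> Y"
    and "g \<in> carrier K" "y \<in> Y"
  shows "\<phi> g y = y"
proof -
  interpret Y: perm_rep K "\<lambda>g y. if y \<in> Y then \<phi> g y else y" Y
    using perm_rep_restrict assms by blast
  show ?thesis using Y.trivial_if_acts_trivially_below[OF assms(1,3,5)] assms(6)
    by (auto simp: fun_eq_iff split: if_splits)
qed

text \<open>
  The group permutes the nontrivial cycles of \<open>c\<close>. There are fewer than \<open>m\<close> of them, because each has at least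
  two points, so every cycle is preserved. On a cycle, permutations commuting with \<open>c\<close> act as powers of
  \<open>c\<close>, so the action there is commutative and hence trivial.
\<close>

lemma (in perm_rep) commuting_permutation_support_disjoint:
  assumes perf: "perfect K" and below: "acts_trivially_below K m" and small: "card X < 2 * m"
    and c: "c permutes X" and comm: "\<And>g. g \<in> carrier K \<Longrightarrow> \<phi> g \<circ> c = c \<circ> \<phi> g"
    and p: "c p \<noteq> p" and g: "g \<in> carrier K"
  shows "\<phi> g p = p"
proof -
  have perm: "permutation c" using c finite permutation_permutes by blast
  have orbit_eq: "Orbits.orbit c y = Orbits.orbit c x" if "y \<in> Orbits.orbit c x" for x y
    using cyclic_on_orbit[OF c finite] that by (rule orbit_cyclic_eq3)
  have self: "x \<in> Orbits.orbit c x" for x using permutation_self_in_orbit[OF perm] .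
  have orbX: "Orbits.orbit c x \<subseteq> X" if "x \<in> X" for x using permutes_orbit_subset[OF c that] .
  have orb_img: "\<phi> g ` Orbits.orbit c x = Orbits.orbit c (\<phi> g x)" if "g \<in> carrier K" for g x
    unfolding orbit_altdef using funpow_commute_apply[OF comm[OF that], symmetric]
    by (auto simp: image_Collect) 
  define S where "S = {x \<in> X. c x \<noteq> x}"
  have S: "\<phi> g x \<in> S" if "g \<in> carrier K" "x \<in> S" for g x
  proof -
    have "c (\<phi> g x) = \<phi> g (c x)" using comm[OF that(1)] by (auto simp: fun_eq_iff)
    then show ?thesis using that in_image inj by (auto simp: S_def)
  qed
  define Y where "Y = Orbits.orbit c ` S"
  have finY: "finite Y" using finite by (simp add: Y_def S_def)
  have fin: "finite A" and two: "2 \<le> card A" if A: "A \<in> Y" for A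
  proof -
    obtain x where x: "A = Orbits.orbit c x" "x \<in> X" "c x \<noteq> x" using A by (auto simp: Y_def S_def)
    show f: "finite A" using x orbX finite finite_subset by metis
    have "{x, c x} \<subseteq> A" using x self Orbits.orbit.base[of c x] by auto
    then have "card {x, c x} \<le> card A" using f card_mono by blast
    then show "2 \<le> card A" using x(3) by simp
  qed
  have "pairwise disjnt Y"
    using orbit_eq by (auto simp: pairwise_def disjnt_def Y_def) blast+
  then have "card (\<Union> Y) = sum card Y" using fin by (intro card_Union_disjoint)
  moreover have "sum card Y \<ge> sum (\<lambda>_. 2) Y" by (rule sum_mono) (rule two)
  moreover have "card (\<Union> Y) \<le> card X"
    by (rule card_mono[OF finite]) (use orbX in \<open>auto simp: Y_def S_def\<close>)
  ultimately have cY: "card Y < m" using small by simp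
  interpret Y: perm_rep K "\<lambda>g y. if y \<in> Y then (`) (\<phi> g) y else y" Y
    by (rule perm_rep_of_action[OF group_axioms finY])
      (use S orb_img in \<open>auto simp: one mult image_comp Y_def\<close>)
  have reach: "\<exists>i. \<phi> g x = (c ^^ i) x" if "g \<in> carrier K" "x \<in> S" for g x
  proof -
    have "Orbits.orbit c x \<in> Y" using that by (simp add: Y_def)
    then have "\<phi> g ` Orbits.orbit c x = Orbits.orbit c x"
      using Y.trivial_if_acts_trivially_below[OF below cY that(1)]
      by (auto simp: fun_eq_iff split: if_splits)
    then have "\<phi> g x \<in> Orbits.orbit c x" using self by blast
    then show ?thesis by (auto simp: orbit_altdef)
  qed
  have "p \<in> S" using p c permutes_not_in by (fastforce simp: S_def)
  show ?thesis
  proof (rule perfect_fixes_if_commuting[OF perf S _ g \<open>p \<in> S\<close>])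
    fix g h x assume gh: "g \<in> carrier K" "h \<in> carrier K" "x \<in> S"
    obtain i j where "\<phi> g x = (c ^^ i) x" "\<phi> h x = (c ^^ j) x" using reach gh by metis
    then show "\<phi> g (\<phi> h x) = \<phi> h (\<phi> g x)"
      using commute_on_cyclic_orbit[OF comm[OF gh(1)] comm[OF gh(2)]] by blast
  qed
qed

section \<open>Braid relations and collapsing generators\<close>

lemma (in group) commuting_braided_eq:
  assumes "x \<in> carrier G" "y \<in> carrier G" "x \<otimes> y = y \<otimes> x" "x \<otimes> y \<otimes> x = y \<otimes> x \<otimes> y"
  shows "x = y"
proof -
  have "(x \<otimes> y) \<otimes> x = (x \<otimes> y) \<otimes> y" using assms(3,4) by simp
  then show ?thesis using assms(1,2) by simp
qed

text \<open>
  Braid relations in an arbitrary group, so that the images of the half twists in quotients of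
  the braid group form such a family, too.
\<close>

locale braid_family = group G for G (structure) +
  fixes s :: "nat \<Rightarrow> 'a" and n :: nat
  assumes closed: "1 \<le> i \<Longrightarrow> i < n \<Longrightarrow> s i \<in> carrier G"
    and far: "1 \<le> i \<Longrightarrow> i + 2 \<le> j \<Longrightarrow> j < n \<Longrightarrow> s i \<otimes> s j = s j \<otimes> s i"
    and braid: "1 \<le> i \<Longrightarrow> i + 1 < n \<Longrightarrow> s i \<otimes> s (i + 1) \<otimes> s i = s (i + 1) \<otimes> s i \<otimes> s (i + 1)"
begin

lemma adjacent_eq_if_commuting:
  assumes "1 \<le> i" "i + 1 < n" "s i \<otimes> s (i + 1) = s (i + 1) \<otimes> s i"
  shows "s i = s (i + 1)"
proof -
  have "s i \<in> carrier G" "s (i + 1) \<in> carrier G" using assms(1,2) closed by auto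
  then show ?thesis using assms(3) braid[OF assms(1,2)] by (rule commuting_braided_eq)
qed

lemma all_equal_if_adjacent_equal:
  assumes i: "1 \<le> i" "i + 1 < n" and eq: "s i = s (i + 1)" and j: "1 \<le> j" "j < n"
  shows "s j = s 1"
proof -
  have up: "s (k + 1) = s (k + 2)" if "1 \<le> k" "k + 2 < n" "s k = s (k + 1)" for k
    using adjacent_eq_if_commuting[of "k + 1"] far[of k "k + 2"] that by (simp add: numeral_2_eq_2)
  have down: "s k = s (k + 1)" if "1 \<le> k" "k + 2 < n" "s (k + 1) = s (k + 2)" for k
    using adjacent_eq_if_commuting[of k] far[of k "k + 2"] that by (simp add: numeral_2_eq_2)
  have D: "s (i - d) = s (i - d + 1)" if "d < i" for d
    using that
  proof (induction d)
    case (Suc d)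
    then have "i - d = i - Suc d + 1" by simp
    then have "s (i - Suc d + 1) = s (i - Suc d + 2)" using Suc by simp
    then show ?case using down[of "i - Suc d"] Suc.prems i by simp
  qed (use eq in simp)
  have first: "s 1 = s 2" using D[of "i - 1"] i by (simp add: numeral_2_eq_2)
  have adj: "s (Suc k) = s (Suc k + 1)" if "Suc k + 1 < n" for k
    using that by (induction k) (use first up in \<open>auto simp: numeral_2_eq_2\<close>)
  have "s (Suc k) = s 1" if "Suc k < n" for k
    using that
  proof (induction k)
    case (Suc k)
    then show ?case using adj[of k] by simp
  qed simp
  then show ?thesis using j by (metis Suc_le_D One_nat_def)
qed

end

text \<open>
  In the braid group on four strands, \<open>z x y z\<close> moves the first two strands as a ribbon across the last two,
  so it exchanges the twists \<open>x\<close> and \<open>y\<close> of the two ribbons.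
\<close>

lemma (in group) swap_commuting_generators:
  assumes "x \<in> carrier G" "y \<in> carrier G" "z \<in> carrier G"
    and "x \<otimes> y = y \<otimes> x" "z \<otimes> x \<otimes> z = x \<otimes> z \<otimes> x" "z \<otimes> y \<otimes> z = y \<otimes> z \<otimes> y"
  shows "(z \<otimes> x \<otimes> y \<otimes> z) \<otimes> x = y \<otimes> (z \<otimes> x \<otimes> y \<otimes> z)"
proof -
  have "(z \<otimes> x \<otimes> y \<otimes> z) \<otimes> x = z \<otimes> y \<otimes> (x \<otimes> z \<otimes> x)" using assms(1-4) by (simp add: m_assoc)
  also have "\<dots> = (z \<otimes> y \<otimes> z) \<otimes> x \<otimes> z" using assms(1-3) assms(5)[symmetric] by (simp add: m_assoc)
  also have "\<dots> = y \<otimes> (z \<otimes> (y \<otimes> x) \<otimes> z)" using assms(1-3,6) by (simp add: m_assoc)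
  also have "\<dots> = y \<otimes> (z \<otimes> x \<otimes> y \<otimes> z)" using assms(1-4) by (simp add: m_assoc)
  finally show ?thesis .
qed

lemma (in group) commute_mult:
  assumes "x \<in> carrier G" "y \<in> carrier G" "z \<in> carrier G" "x \<otimes> z = z \<otimes> x" "y \<otimes> z = z \<otimes> y"
  shows "(x \<otimes> y) \<otimes> z = z \<otimes> (x \<otimes> y)"
  using assms by (metis m_assoc)

lemma (in group) commute_inv:
  assumes "x \<in> carrier G" "z \<in> carrier G" "x \<otimes> z = z \<otimes> x"
  shows "inv x \<otimes> z = z \<otimes> inv x"
  using assms by (metis inv_closed inv_solve_left inv_solve_right m_assoc m_closed)

lemma (in group) conjugate_cube:
  assumes "p \<in> carrier G" "x \<in> carrier G" "y \<in> carrier G" and eq: "p \<otimes> x = y \<otimes> p"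
  shows "p \<otimes> (x \<otimes> x \<otimes> x) = (y \<otimes> y \<otimes> y) \<otimes> p"
proof -
  have "p \<otimes> (x \<otimes> x \<otimes> x) = (p \<otimes> x) \<otimes> x \<otimes> x" using assms(1-3) by (simp add: m_assoc)
  also have "\<dots> = (y \<otimes> p) \<otimes> x \<otimes> x" by (simp only: eq)
  also have "\<dots> = y \<otimes> (p \<otimes> x) \<otimes> x" using assms(1-3) by (simp add: m_assoc)
  also have "\<dots> = y \<otimes> (y \<otimes> p) \<otimes> x" by (simp only: eq)
  also have "\<dots> = y \<otimes> (y \<otimes> (p \<otimes> x))" using assms(1-3) by (simp add: m_assoc)
  also have "\<dots> = (y \<otimes> y \<otimes> y) \<otimes> p" unfolding eq using assms(1-3) by (simp add: m_assoc)
  finally show ?thesis .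
qed

text \<open>
  Conjugation by ribbon moves permutes \<open>s\<^sub>1\<close>, \<open>s\<^sub>3\<close>, \<open>s\<^sub>5\<close>, so the product of any two of them is the square of the
  third. Consequently \<open>s\<^sub>1\<close> and \<open>s\<^sub>5\<close> have the same cube; it commutes with \<open>s\<^sub>2\<close>, and therefore it is also the cube of
  \<open>s\<^sub>2\<close>, which is conjugate to \<open>s\<^sub>1\<close> by \<open>s\<^sub>1 s\<^sub>2\<close>. Comparing with the ribbon move that exchanges \<open>s\<^sub>1\<close> and \<open>s\<^sub>3\<close> gives \<open>s\<^sub>1 s\<^sub>2 = s\<^sub>2 s\<^sub>3\<close>, and
  the braid relation turns this into \<open>s\<^sub>2 = s\<^sub>3\<close>.
\<close>

lemma (in braid_family) generator_collapse_of_square_relation: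
  assumes n: "n \<ge> 6" and rel: "s 1 \<otimes> s 3 = s 5 \<otimes> s 5"
  shows "s 2 = s 3"
proof -
  define a b c d e where "a = s 1" and "b = s 2" and "c = s 3" and "d = s 4" and "e = s 5"
  note defs = a_def b_def c_def d_def e_def
  have C: "a \<in> carrier G" "b \<in> carrier G" "c \<in> carrier G" "d \<in> carrier G" "e \<in> carrier G"
    unfolding defs using n closed by auto
  have ac: "a \<otimes> c = c \<otimes> a" and ad: "a \<otimes> d = d \<otimes> a" and ae: "a \<otimes> e = e \<otimes> a"
    and be: "b \<otimes> e = e \<otimes> b" and ce: "c \<otimes> e = e \<otimes> c"
    unfolding defs using n far[of 1 3] far[of 1 4] far[of 1 5] far[of 2 5] far[of 3 5] by auto
  have aba: "a \<otimes> b \<otimes> a = b \<otimes> a \<otimes> b" and bcb: "b \<otimes> c \<otimes> b = c \<otimes> b \<otimes> c"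
    and cdc: "c \<otimes> d \<otimes> c = d \<otimes> c \<otimes> d" and ded: "d \<otimes> e \<otimes> d = e \<otimes> d \<otimes> e"
    unfolding defs using n braid[of 1] braid[of 2] braid[of 3] braid[of 4]
    by (auto simp: numeral_eq_Suc)
  have rel1: "a \<otimes> c = e \<otimes> e" using rel by (simp add: defs)
  have rel2: "a \<otimes> e = c \<otimes> c"
  proof -
    let ?w = "d \<otimes> c \<otimes> e \<otimes> d"
    have w: "?w \<in> carrier G" using C by simp
    have wc: "?w \<otimes> c = e \<otimes> ?w"
      by (rule swap_commuting_generators) (use C ce cdc ded in auto)
    have "d \<otimes> e \<otimes> c \<otimes> d \<otimes> e = c \<otimes> (d \<otimes> e \<otimes> c \<otimes> d)"
      by (rule swap_commuting_generators) (use C ce cdc ded in auto)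
    then have we: "?w \<otimes> e = c \<otimes> ?w" using C ce by (simp add: m_assoc)
    have wa: "?w \<otimes> a = a \<otimes> ?w" using C ac ad ae by (intro commute_mult) auto
    have "(a \<otimes> e) \<otimes> ?w = ?w \<otimes> (a \<otimes> c)" using C w wa wc by (metis m_assoc)
    also have "\<dots> = (c \<otimes> c) \<otimes> ?w" unfolding rel1 using C w we by (metis m_assoc)
    finally show ?thesis using C w by simp
  qed
  have rel3: "c \<otimes> e = a \<otimes> a"
  proof -
    let ?v = "b \<otimes> a \<otimes> c \<otimes> b"
    have v: "?v \<in> carrier G" using C by simp
    have va: "?v \<otimes> a = c \<otimes> ?v"
      by (rule swap_commuting_generators) (use C ac aba bcb in auto)
    have "b \<otimes> c \<otimes> a \<otimes> b \<otimes> c = a \<otimes> (b \<otimes> c \<otimes> a \<otimes> b)"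
      by (rule swap_commuting_generators) (use C ac aba bcb in auto)
    then have vc: "?v \<otimes> c = a \<otimes> ?v" using C ac by (simp add: m_assoc)
    have ve: "?v \<otimes> e = e \<otimes> ?v" using C ae be ce by (intro commute_mult) auto
    have "(c \<otimes> e) \<otimes> ?v = ?v \<otimes> (a \<otimes> e)" using C v va ve by (metis m_assoc)
    also have "\<dots> = (a \<otimes> a) \<otimes> ?v" unfolding rel2 using C v vc by (metis m_assoc)
    finally show ?thesis using C v by simp
  qed
  have aaa: "a \<otimes> a \<otimes> a = e \<otimes> e \<otimes> e"
    using C rel1 rel3 ac ce ae by (metis m_assoc)
  \<comment> \<open>Via the equal cube of e, which is far from b.\<close>
  have b_aaa: "b \<otimes> (a \<otimes> a \<otimes> a) = (a \<otimes> a \<otimes> a) \<otimes> b"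
    unfolding aaa using C be by (intro commute_mult[symmetric] commute_mult) auto
  have cubes: "b \<otimes> b \<otimes> b = a \<otimes> a \<otimes> a"
  proof -
    have ab: "(a \<otimes> b) \<otimes> a = b \<otimes> (a \<otimes> b)" using C aba by (simp add: m_assoc)
    have "(b \<otimes> b \<otimes> b) \<otimes> (a \<otimes> b) = (a \<otimes> b) \<otimes> (a \<otimes> a \<otimes> a)"
      using C ab by (intro conjugate_cube[symmetric]) auto
    also have "\<dots> = (a \<otimes> a \<otimes> a) \<otimes> (a \<otimes> b)"
      using C b_aaa by (simp add: m_assoc)
    finally show ?thesis using C by simp
  qed
  have bac: "b \<otimes> (a \<otimes> c) = (a \<otimes> c) \<otimes> b"
    unfolding rel1 using C be by (intro commute_mult[symmetric]) auto
  have bba: "b \<otimes> b \<otimes> a = c \<otimes> (b \<otimes> b)"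
  proof -
    have "(b \<otimes> a \<otimes> c \<otimes> b) \<otimes> a = c \<otimes> (b \<otimes> a \<otimes> c \<otimes> b)"
      by (rule swap_commuting_generators) (use C ac aba bcb in auto)
    then have "(b \<otimes> (a \<otimes> c)) \<otimes> (b \<otimes> a) = c \<otimes> ((b \<otimes> (a \<otimes> c)) \<otimes> b)"
      using C by (simp add: m_assoc)
    then have "(a \<otimes> c) \<otimes> (b \<otimes> b \<otimes> a) = (c \<otimes> (a \<otimes> c)) \<otimes> (b \<otimes> b)"
      unfolding bac using C by (simp add: m_assoc)
    also have "\<dots> = ((a \<otimes> c) \<otimes> c) \<otimes> (b \<otimes> b)"
      using m_assoc[OF C(3,1,3)] by (simp only: ac)
    finally have "(a \<otimes> c) \<otimes> (b \<otimes> b \<otimes> a) = (a \<otimes> c) \<otimes> (c \<otimes> (b \<otimes> b))"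
      using C by (simp add: m_assoc)
    then show ?thesis using C by simp
  qed
  have "(a \<otimes> b) \<otimes> (b \<otimes> b) = a \<otimes> (b \<otimes> b \<otimes> b)" using C by (simp add: m_assoc)
  also have "\<dots> = (b \<otimes> b \<otimes> b) \<otimes> a" unfolding cubes using C by (simp add: m_assoc)
  also have "\<dots> = b \<otimes> (b \<otimes> b \<otimes> a)" using C by (simp add: m_assoc)
  also have "\<dots> = (b \<otimes> c) \<otimes> (b \<otimes> b)" unfolding bba using C by (simp add: m_assoc)
  finally have abc: "a \<otimes> b = b \<otimes> c" using C by simp
  have "(b \<otimes> a) \<otimes> b = (a \<otimes> b) \<otimes> a" by (rule aba[symmetric])
  also have "\<dots> = b \<otimes> (c \<otimes> a)" unfolding abc using C by (simp add: m_assoc)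
  also have "\<dots> = (b \<otimes> a) \<otimes> c" using C by (simp add: m_assoc flip: ac)
  finally have "(b \<otimes> a) \<otimes> b = (b \<otimes> a) \<otimes> c" .
  then show ?thesis using C by (simp add: b_def c_def)
qed

lemma (in group) braided_reversal_eq:
  assumes "p \<in> carrier G" "q \<in> carrier G" "r \<in> carrier G"
    and "p \<otimes> r = r \<otimes> p" "p \<otimes> q \<otimes> p = q \<otimes> p \<otimes> q" "q \<otimes> r \<otimes> q = r \<otimes> q \<otimes> r"
    and "r \<otimes> q \<otimes> p = p \<otimes> q \<otimes> r"
  shows "p = r"
proof -
  have "(r \<otimes> q \<otimes> p) \<otimes> q = p \<otimes> (q \<otimes> r \<otimes> q)" using assms by (simp add: m_assoc)
  also have "\<dots> = r \<otimes> (p \<otimes> q \<otimes> r)" using assms by (metis m_assoc m_closed)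
  finally have "r \<otimes> (q \<otimes> p \<otimes> q) = r \<otimes> (p \<otimes> q \<otimes> r)" using assms(1-3) by (simp add: m_assoc)
  then have "(p \<otimes> q) \<otimes> p = (p \<otimes> q) \<otimes> r" using assms(1-3) assms(5) by simp
  then show ?thesis using assms(1-3) by simp
qed

lemma (in braid_family) hom_image:
  assumes "group Q" "\<pi> \<in> hom G Q"
  shows "braid_family Q (\<lambda>i. \<pi> (s i)) n"
proof -
  interpret Q: group Q by fact
  interpret h: group_hom G Q \<pi> using assms by (unfold_locales) auto
  show ?thesis
  proof
    show "1 \<le> i \<Longrightarrow> i < n \<Longrightarrow> \<pi> (s i) \<in> carrier Q" for i using closed h.hom_closed by blast
    show "\<pi> (s i) \<otimes>\<^bsub>Q\<^esub> \<pi> (s j) = \<pi> (s j) \<otimes>\<^bsub>Q\<^esub> \<pi> (s i)" if "1 \<le> i" "i + 2 \<le> j" "j < n" for i j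
    proof -
      have C: "s i \<in> carrier G" "s j \<in> carrier G" using that closed by auto
      show ?thesis
        using arg_cong[OF far[OF that], of \<pi>] h.hom_mult[OF C] h.hom_mult[OF C(2,1)] by argo
    qed
    show "\<pi> (s i) \<otimes>\<^bsub>Q\<^esub> \<pi> (s (i + 1)) \<otimes>\<^bsub>Q\<^esub> \<pi> (s i)
        = \<pi> (s (i + 1)) \<otimes>\<^bsub>Q\<^esub> \<pi> (s i) \<otimes>\<^bsub>Q\<^esub> \<pi> (s (i + 1))" if "1 \<le> i" "i + 1 < n" for i
    proof -
      have C: "s i \<in> carrier G" "s (i + 1) \<in> carrier G" using that closed by auto
      have "\<pi> (s i \<otimes> s (i + 1) \<otimes> s i) = \<pi> (s i) \<otimes>\<^bsub>Q\<^esub> \<pi> (s (i + 1)) \<otimes>\<^bsub>Q\<^esub> \<pi> (s i)"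
        "\<pi> (s (i + 1) \<otimes> s i \<otimes> s (i + 1)) = \<pi> (s (i + 1)) \<otimes>\<^bsub>Q\<^esub> \<pi> (s i) \<otimes>\<^bsub>Q\<^esub> \<pi> (s (i + 1))"
        using C by (simp_all only: h.hom_mult m_closed)
      then show ?thesis using braid[OF that] by argo
    qed
  qed
qed

lemma (in group) rcos_eq_iff:
  assumes "subgroup N G" "x \<in> carrier G" "y \<in> carrier G"
  shows "N #> x = N #> y \<longleftrightarrow> x \<otimes> inv y \<in> N"
proof -
  have "N #> x = N #> y \<longleftrightarrow> x \<in> N #> y"
    using rcos_self[OF assms(2,1)] repr_independence[OF _ assms(3,1), of x] by auto
  also have "\<dots> \<longleftrightarrow> x \<otimes> inv y \<in> N"
    using subgroup.rcos_module[OF assms(1) is_group assms(3,2)] .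
  finally show ?thesis .
qed

lemma (in group) quotient_mult:
  assumes "x \<in> carrier G" "y \<in> carrier G" "z \<in> carrier G"
  shows "(x \<otimes> inv y) \<otimes> (y \<otimes> inv z) = x \<otimes> inv z"
proof -
  have "(x \<otimes> inv y) \<otimes> (y \<otimes> inv z) = x \<otimes> (inv y \<otimes> y) \<otimes> inv z"
    using assms by (simp only: m_assoc m_closed inv_closed)
  then show ?thesis using assms by simp
qed

lemma (in group) quotient_inv:
  "x \<in> carrier G \<Longrightarrow> y \<in> carrier G \<Longrightarrow> inv (x \<otimes> inv y) = y \<otimes> inv x"
  by (simp add: inv_mult_group)

text \<open>
  With at least five strands there is a generator \<open>s\<^sub>4\<close> far from both \<open>s\<^sub>1\<close> and \<open>s\<^sub>2\<close>; this is what makes the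
  commutator subgroup perfect.
\<close>

locale braid_generated = braid_family +
  assumes gen: "carrier G = generate G (s ` {1..<n})"
    and five: "5 \<le> n"
begin

abbreviation D where "D \<equiv> derived G (carrier G)"

lemma D_subgroup: "subgroup D G" by (rule derived_is_subgroup) simp

lemma D_normal: "D \<lhd> G" by (rule derived_self_is_normal)

lemma D_carrier: "g \<in> D \<Longrightarrow> g \<in> carrier G" using D_subgroup subgroup.mem_carrier by metis

lemma D_conj: "h \<in> carrier G \<Longrightarrow> g \<in> D \<Longrightarrow> h \<otimes> g \<otimes> inv h \<in> D"
  using D_normal by (simp add: normal_inv_iff)

lemma commutator_in_D: "g \<in> carrier G \<Longrightarrow> h \<in> carrier G \<Longrightarrow> g \<otimes> h \<otimes> inv g \<otimes> inv h \<in> D"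
  unfolding derived_def by (rule generate.incl) auto

lemma far': "1 \<le> i \<Longrightarrow> i < n \<Longrightarrow> 1 \<le> j \<Longrightarrow> j < n \<Longrightarrow> i + 2 \<le> j \<or> j + 2 \<le> i \<Longrightarrow> s i \<otimes> s j = s j \<otimes> s i"
  using far[of i j] far[of j i] by auto

lemma quotient_in_D:
  assumes "1 \<le> i" "i < n" "1 \<le> j" "j < n"
  shows "s i \<otimes> inv s j \<in> D"
proof -
  have adj: "s (k + 1) \<otimes> inv s k \<in> D" if k: "1 \<le> k" "k + 1 < n" for k
  proof -
    have C: "s k \<in> carrier G" "s (k + 1) \<in> carrier G" using k closed by auto
    \<comment> \<open>Adjacent generators are conjugate by this product, so their quotient is a commutator.\<close>
    let ?h = "s k \<otimes> s (k + 1)"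
    have "?h \<otimes> s k = s (k + 1) \<otimes> ?h" using C braid[OF k] by (simp add: m_assoc)
    then have "?h \<otimes> s k \<otimes> inv ?h = s (k + 1)" using C by (simp add: m_assoc)
    then show ?thesis using commutator_in_D[of ?h "s k"] C by simp
  qed
  have *: "s (Suc k) \<otimes> inv s 1 \<in> D" if "Suc k < n" for k
    using that
  proof (induction k)
    case 0
    then show ?case using closed[of 1] subgroup.one_closed[OF D_subgroup] by simp
  next
    case (Suc k)
    have C: "s (Suc k) \<in> carrier G" "s (Suc (Suc k)) \<in> carrier G" "s 1 \<in> carrier G"
      using Suc.prems closed by auto
    have "(s (Suc (Suc k)) \<otimes> inv s (Suc k)) \<otimes> (s (Suc k) \<otimes> inv s 1) \<in> D"
      using adj[of "Suc k"] Suc by (simp add: subgroup.m_closed[OF D_subgroup])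
    moreover have "(s (Suc (Suc k)) \<otimes> inv s (Suc k)) \<otimes> (s (Suc k) \<otimes> inv s 1)
        = s (Suc (Suc k)) \<otimes> inv s 1"
      using C by (intro quotient_mult)
    ultimately show ?case by simp
  qed
  have "s i \<otimes> inv s 1 \<in> D" "s j \<otimes> inv s 1 \<in> D"
    using *[of "i - 1"] *[of "j - 1"] assms by auto
  then have "(s i \<otimes> inv s 1) \<otimes> inv (s j \<otimes> inv s 1) \<in> D"
    using D_subgroup subgroup.m_closed subgroup.m_inv_closed by metis
  moreover have "(s i \<otimes> inv s 1) \<otimes> inv (s j \<otimes> inv s 1) = s i \<otimes> inv s j"
    using closed[of i] closed[of j] closed[of 1] assms five by (simp add: quotient_inv quotient_mult)
  ultimately show ?thesis by simp
qed

text \<open>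
  Modulo \<open>N\<close> two adjacent generators agree, hence all of them do, and the quotient is cyclic.
\<close>

lemma derived_le_normal:
  assumes N: "N \<lhd> G" and i: "1 \<le> i" "i + 1 < n" and eq: "N #> s i = N #> s (i + 1)"
  shows "D \<subseteq> N"
proof -
  interpret N: normal N G by fact
  interpret Q: group "G Mod N" by (rule N.factorgroup_is_group)
  interpret h: group_hom G "G Mod N" "(#>) N"
    using N.r_coset_hom_Mod by unfold_locales
  interpret F: braid_family "G Mod N" "\<lambda>i. N #> s i" n
    using hom_image[OF Q.group_axioms N.r_coset_hom_Mod] .
  let ?t = "N #> s 1"
  have t: "?t \<in> carrier (G Mod N)" using closed[of 1] five h.hom_closed by simp
  have st: "N #> s j = ?t" if "1 \<le> j" "j < n" for j
    using F.all_equal_if_adjacent_equal[OF i eq that] .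
  have pow: "\<exists>z::int. N #> h = ?t [^]\<^bsub>G Mod N\<^esub> z" if "h \<in> generate G (s ` {1..<n})" for h
    using that
  proof induction
    case one
    show ?case by (rule exI[of _ 0]) (use h.hom_one in simp)
  next
    case (incl h)
    then obtain j where "h = s j" "1 \<le> j" "j < n" by auto
    then have "N #> h = ?t" using st[of j] by metis
    then show ?case using Q.int_pow_1[OF t] by metis
  next
    case (inv h)
    then obtain j where "h = s j" "1 \<le> j" "j < n" by auto
    then have "h \<in> carrier G" "N #> h = ?t" using closed[of j] st[of j] by metis+
    then have "N #> inv h = ?t [^]\<^bsub>G Mod N\<^esub> (-1 :: int)"
      using Q.int_pow_neg[OF t, of 1] Q.int_pow_1[OF t] h.hom_inv by metis
    then show ?case ..
  next
    case (eng h1 h2)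
    then obtain y z :: int where "N #> h1 = ?t [^]\<^bsub>G Mod N\<^esub> y" "N #> h2 = ?t [^]\<^bsub>G Mod N\<^esub> z" by blast
    moreover have "h1 \<in> carrier G" "h2 \<in> carrier G" using eng gen by auto
    ultimately have "N #> (h1 \<otimes> h2) = ?t [^]\<^bsub>G Mod N\<^esub> (y + z)"
      using t by (simp only: h.hom_mult Q.int_pow_mult)
    then show ?case ..
  qed
  show ?thesis
    unfolding derived_def
  proof (rule generate_subgroup_incl[OF _ N.subgroup_axioms], rule subsetI)
    fix x assume "x \<in> derived_set G (carrier G)"
    then obtain g k where gk: "g \<in> carrier G" "k \<in> carrier G" and x: "x = g \<otimes> k \<otimes> inv g \<otimes> inv k"
      by blast
    obtain y z :: int where "N #> g = ?t [^]\<^bsub>G Mod N\<^esub> y" "N #> k = ?t [^]\<^bsub>G Mod N\<^esub> z"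
      using pow[of g] pow[of k] gk gen by metis
    then have "(N #> g) \<otimes>\<^bsub>G Mod N\<^esub> (N #> k) = (N #> k) \<otimes>\<^bsub>G Mod N\<^esub> (N #> g)"
      using t by (metis Q.int_pow_mult add.commute)
    then have "N #> (g \<otimes> k) = N #> (k \<otimes> g)" using gk by (simp only: h.hom_mult)
    then have "(g \<otimes> k) \<otimes> inv (k \<otimes> g) \<in> N"
      using rcos_eq_iff[OF N.subgroup_axioms, of "g \<otimes> k" "k \<otimes> g"] gk by blast
    moreover have "(g \<otimes> k) \<otimes> inv (k \<otimes> g) = x" using gk by (simp add: x inv_mult_group m_assoc)
    ultimately show "x \<in> N" by simp
  qed
qed

end

section \<open>Actions of the commutator subgroup\<close>

context group
begin

text \<open>
  Dividing by a commuting element \<open>c\<close> preserves commutation and braid relations. With a far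
  generator for \<open>c\<close>, this moves generators into the commutator subgroup.
\<close>

lemma twisted_mult:
  assumes "x \<in> carrier G" "y \<in> carrier G" "c \<in> carrier G" "y \<otimes> c = c \<otimes> y"
  shows "(x \<otimes> inv c) \<otimes> (y \<otimes> inv c) = (x \<otimes> y) \<otimes> inv (c \<otimes> c)"
proof -
  have "inv c \<otimes> y = y \<otimes> inv c" using commute_inv[of c y] assms by simp
  then have "x \<otimes> (inv c \<otimes> y) \<otimes> inv c = x \<otimes> (y \<otimes> inv c) \<otimes> inv c" by simp
  then show ?thesis using assms(1-3) by (simp add: m_assoc inv_mult_group)
qed

lemma twisted_commute:
  assumes "x \<in> carrier G" "y \<in> carrier G" "c \<in> carrier G"
    and "x \<otimes> y = y \<otimes> x" "x \<otimes> c = c \<otimes> x" "y \<otimes> c = c \<otimes> y"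
  shows "(x \<otimes> inv c) \<otimes> (y \<otimes> inv c) = (y \<otimes> inv c) \<otimes> (x \<otimes> inv c)"
  using twisted_mult[OF assms(1,2,3,6)] twisted_mult[OF assms(2,1,3,5)] assms(4) by simp

lemma twisted_braid:
  assumes C: "x \<in> carrier G" "y \<in> carrier G" "c \<in> carrier G"
    and br: "x \<otimes> y \<otimes> x = y \<otimes> x \<otimes> y" and xc: "x \<otimes> c = c \<otimes> x" and yc: "y \<otimes> c = c \<otimes> y"
  shows "(x \<otimes> inv c) \<otimes> (y \<otimes> inv c) \<otimes> (x \<otimes> inv c)
       = (y \<otimes> inv c) \<otimes> (x \<otimes> inv c) \<otimes> (y \<otimes> inv c)"
proof -
  have *: "(u \<otimes> inv c) \<otimes> (v \<otimes> inv c) \<otimes> (u \<otimes> inv c) = (u \<otimes> v \<otimes> u) \<otimes> inv (c \<otimes> c \<otimes> c)"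
    if "u \<in> carrier G" "v \<in> carrier G" "u \<otimes> c = c \<otimes> u" "v \<otimes> c = c \<otimes> v" for u v
  proof -
    have "(u \<otimes> inv c) \<otimes> (v \<otimes> inv c) \<otimes> (u \<otimes> inv c) = (u \<otimes> v) \<otimes> (inv (c \<otimes> c) \<otimes> u) \<otimes> inv c"
      using twisted_mult[of u v c] that C by (simp add: m_assoc)
    also have "inv (c \<otimes> c) \<otimes> u = u \<otimes> inv (c \<otimes> c)"
      using that C by (intro commute_inv commute_mult) auto
    finally show ?thesis using that C by (simp add: m_assoc inv_mult_group)
  qed
  show ?thesis using *[OF C(1,2) xc yc] *[OF C(2,1) yc xc] br by simp
qed

lemma commute_if_twisted_commute:
  assumes C: "x \<in> carrier G" "y \<in> carrier G" "c \<in> carrier G"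
    and xc: "x \<otimes> c = c \<otimes> x" and yc: "y \<otimes> c = c \<otimes> y"
    and eq: "(x \<otimes> inv c) \<otimes> (x \<otimes> inv y) = (x \<otimes> inv y) \<otimes> (x \<otimes> inv c)"
  shows "x \<otimes> y = y \<otimes> x"
proof -
  have "inv y \<otimes> c = c \<otimes> inv y" using commute_inv[OF C(2,3) yc] .
  then have "(x \<otimes> inv y) \<otimes> c = c \<otimes> (x \<otimes> inv y)" using C xc by (intro commute_mult) auto
  then have "inv c \<otimes> (x \<otimes> inv y) = (x \<otimes> inv y) \<otimes> inv c" using C by (intro commute_inv) auto
  then have "x \<otimes> ((x \<otimes> inv y) \<otimes> inv c) = (x \<otimes> inv c) \<otimes> (x \<otimes> inv y)" using C by (simp add: m_assoc)
  also have "\<dots> = x \<otimes> ((inv y \<otimes> x) \<otimes> inv c)" unfolding eq using C by (simp add: m_assoc)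
  finally have "inv y \<otimes> x = x \<otimes> inv y" using C by simp
  then show ?thesis using commute_inv[of "inv y" x] C by simp
qed

lemma reversal_if_quotients_commute:
  assumes C: "p \<in> carrier G" "q \<in> carrier G" "r \<in> carrier G" and pr: "p \<otimes> r = r \<otimes> p"
    and eq: "(q \<otimes> inv p) \<otimes> (p \<otimes> inv r) = (p \<otimes> inv r) \<otimes> (q \<otimes> inv p)"
  shows "r \<otimes> q \<otimes> p = p \<otimes> q \<otimes> r"
proof -
  have "r \<otimes> q \<otimes> p = r \<otimes> (q \<otimes> inv r) \<otimes> (r \<otimes> p)"
    using quotient_mult[of q r "inv p"] C by (simp add: m_assoc)
  also have "q \<otimes> inv r = (p \<otimes> inv r) \<otimes> (q \<otimes> inv p)"
    using eq quotient_mult[of q p r] C by simp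
  also have "p \<otimes> inv r = inv r \<otimes> p" using commute_inv[of r p] C pr by simp
  also have "r \<otimes> (inv r \<otimes> p \<otimes> (q \<otimes> inv p)) \<otimes> (r \<otimes> p) = (r \<otimes> inv r) \<otimes> (p \<otimes> q) \<otimes> (inv p \<otimes> (r \<otimes> p))"
    using C by (simp only: m_assoc m_closed inv_closed)
  also have "inv p \<otimes> (r \<otimes> p) = (inv p \<otimes> p) \<otimes> r" using C pr by (simp only: m_assoc inv_closed)
  finally show ?thesis using C by simp
qed

lemma conjugate_by_mult:
  assumes "x \<in> carrier G" "y \<in> carrier G" "g \<in> carrier G"
  shows "(x \<otimes> y) \<otimes> g \<otimes> inv (x \<otimes> y) = x \<otimes> (y \<otimes> g \<otimes> inv y) \<otimes> inv x"
  using assms by (simp add: m_assoc inv_mult_group)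

end

context braid_generated
begin

abbreviation K where "K \<equiv> G\<lparr>carrier := D\<rparr>"

lemma K_group: "group K" by (rule subgroup.subgroup_is_group[OF D_subgroup is_group])

lemma K_inv: "g \<in> D \<Longrightarrow> inv\<^bsub>K\<^esub> g = inv g" using m_inv_consistent[OF D_subgroup] .

text \<open>
  Modulo the second derived subgroup, elements of the first one commute with each other. So conjugation of
  \<open>s\<^sub>1 s\<^sub>2\<^sup>-\<^sup>1\<close> by \<open>s\<^sub>1\<close> and by \<open>s\<^sub>4\<close> has the same effect, namely none. Hence \<open>s\<^sub>1\<close> and \<open>s\<^sub>2\<close> commute, and
  coincide, in the quotient.
\<close>

lemma commutator_subgroup_perfect: "perfect K"
proof -
  let ?N = "derived G D"
  have N: "?N \<lhd> G" by (rule derived_is_normal[OF D_normal])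
  interpret N: normal ?N G by (rule N)
  have C: "s 1 \<in> carrier G" "s 2 \<in> carrier G" "s 4 \<in> carrier G" using closed five by auto
  have *: "?N #> ((s 1 \<otimes> inv s 4) \<otimes> (s 1 \<otimes> inv s 2)) = ?N #> ((s 1 \<otimes> inv s 2) \<otimes> (s 1 \<otimes> inv s 4))"
    (is "_ #> (?u \<otimes> ?g) = _")
  proof -
    have uD: "?u \<in> D" and gD: "?g \<in> D" using quotient_in_D five by auto
    have "?u \<otimes> ?g \<otimes> inv ?u \<otimes> inv ?g \<in> ?N"
      unfolding derived_def[of G D] by (rule generate.incl) (use uD gD in blast)
    also have "?u \<otimes> ?g \<otimes> inv ?u \<otimes> inv ?g = (?u \<otimes> ?g) \<otimes> inv (?g \<otimes> ?u)"
      using uD gD D_carrier by (simp add: inv_mult_group m_assoc)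
    finally show ?thesis
      using rcos_eq_iff[OF N.subgroup_axioms, of "?u \<otimes> ?g" "?g \<otimes> ?u"] uD gD D_carrier by blast
  qed
  interpret Q: group "G Mod ?N" by (rule N.factorgroup_is_group)
  interpret h: group_hom G "G Mod ?N" "(#>) ?N"
    using N.r_coset_hom_Mod by unfold_locales
  interpret F: braid_family "G Mod ?N" "\<lambda>i. ?N #> s i" n
    using hom_image[OF Q.group_axioms N.r_coset_hom_Mod] .
  note [simp del] = one_FactGroup mult_FactGroup
  have "?N #> s 1 = ?N #> s (1 + 1)"
  proof (rule F.adjacent_eq_if_commuting)
    have t: "?N #> s i \<in> carrier (G Mod ?N)" "?N #> inv s i = inv\<^bsub>G Mod ?N\<^esub> (?N #> s i)"
      if "s i \<in> carrier G" for i using that h.hom_closed h.hom_inv by auto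
    show "(?N #> s 1) \<otimes>\<^bsub>G Mod ?N\<^esub> (?N #> s (1 + 1)) = (?N #> s (1 + 1)) \<otimes>\<^bsub>G Mod ?N\<^esub> (?N #> s 1)"
      unfolding one_add_one
    proof (rule Q.commute_if_twisted_commute[of _ _ "?N #> s 4"])
      show "(?N #> s 1) \<otimes>\<^bsub>G Mod ?N\<^esub> (?N #> s 4) = (?N #> s 4) \<otimes>\<^bsub>G Mod ?N\<^esub> (?N #> s 1)"
        using F.far[of 1 4] five by simp
      show "(?N #> s 2) \<otimes>\<^bsub>G Mod ?N\<^esub> (?N #> s 4) = (?N #> s 4) \<otimes>\<^bsub>G Mod ?N\<^esub> (?N #> s 2)"
        using F.far[of 2 4] five by simp
    qed (use * C t in simp_all)
  qed (use five in auto)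
  then have "D \<subseteq> ?N" using derived_le_normal[OF N, of 1] five by simp
  moreover have "?N \<subseteq> D" using derived_incl[OF subset_refl D_subgroup] .
  ultimately show ?thesis
    unfolding perfect_def using derived_consistent[OF subset_refl D_subgroup] by simp
qed

end

text \<open>
  An action of the commutator subgroup alone; it need not extend to the whole group, so its kernel need not be
  normal there.
\<close>

locale braid_rep = braid_generated G s n + rep: perm_rep "G\<lparr>carrier := derived G (carrier G)\<rparr>" \<phi> X
  for G :: "('a, 'b) monoid_scheme" (structure) and s n and \<phi> :: "'a \<Rightarrow> 'x \<Rightarrow> 'x" and X
begin

lemma rep_mult: "g \<in> D \<Longrightarrow> h \<in> D \<Longrightarrow> \<phi> (g \<otimes> h) = \<phi> g \<circ> \<phi> h"
  using rep.mult by simp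

lemma rep_one: "\<phi> \<one> = id"
  using rep.one by simp

lemma rep_inv_left: "g \<in> D \<Longrightarrow> \<phi> (inv g) \<circ> \<phi> g = id"
  and rep_inv_right: "g \<in> D \<Longrightarrow> \<phi> g \<circ> \<phi> (inv g) = id"
  using rep.inv_left[of g] rep.inv_right[of g] K_inv[of g] by (auto simp: fun_eq_iff)

lemma rep_permutes: "g \<in> D \<Longrightarrow> \<phi> g permutes X"
  using rep.permutes by simp

lemma rep_even: "g \<in> D \<Longrightarrow> sign (\<phi> g) = 1"
  using rep.perfect_even[OF commutator_subgroup_perfect] by simp

lemma rep_quotient_eq_id_iff:
  assumes "g \<in> D" "h \<in> D"
  shows "\<phi> (g \<otimes> inv h) = id \<longleftrightarrow> \<phi> g = \<phi> h"
proof -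
  have hD: "inv h \<in> D" using assms D_subgroup subgroup.m_inv_closed by metis
  have "\<phi> g = \<phi> (g \<otimes> inv h) \<circ> \<phi> h"
    using rep_mult[OF assms(1) hD] rep_inv_left[OF assms(2)] by (simp add: comp_assoc)
  then show ?thesis
    using rep_mult[OF assms(1) hD] rep_inv_right[OF assms(2)] by auto
qed

text \<open>
  The largest subgroup of the kernel that is normal in the whole group.
\<close>

definition core where "core = {g \<in> D. \<forall>h\<in>carrier G. \<phi> (h \<otimes> g \<otimes> inv h) = id}"

lemma core_normal: "core \<lhd> G"
proof (rule normal_invI)
  show "subgroup core G"
  proof (rule subgroupI)
    show "core \<subseteq> carrier G" using D_carrier by (auto simp: core_def)
    have "\<one> \<in> core" using subgroup.one_closed[OF D_subgroup] rep_one by (simp add: core_def)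
    then show "core \<noteq> {}" by blast
    show "inv g \<in> core" if g: "g \<in> core" for g
    proof -
      have gD: "g \<in> D" "g \<in> carrier G" using g D_carrier by (auto simp: core_def)
      have "\<phi> (h \<otimes> inv g \<otimes> inv h) = id" if h: "h \<in> carrier G" for h
      proof -
        have e: "inv (h \<otimes> g \<otimes> inv h) = h \<otimes> inv g \<otimes> inv h"
          using h gD by (simp add: inv_mult_group m_assoc)
        have "\<phi> (h \<otimes> g \<otimes> inv h) = id" using g h by (simp add: core_def)
        then show ?thesis using rep_inv_left[OF D_conj[OF h gD(1)]] e by simp
      qed
      then show ?thesis using gD D_subgroup by (simp add: core_def subgroup.m_inv_closed)
    qed
    show "g \<otimes> k \<in> core" if gk: "g \<in> core" "k \<in> core" for g k
    proof -
      have gD: "g \<in> D" "k \<in> D" "g \<in> carrier G" "k \<in> carrier G"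
        using gk D_carrier by (auto simp: core_def)
      have "\<phi> (h \<otimes> (g \<otimes> k) \<otimes> inv h) = id" if h: "h \<in> carrier G" for h
      proof -
        have "h \<otimes> (g \<otimes> k) \<otimes> inv h = (h \<otimes> g \<otimes> inv h) \<otimes> (h \<otimes> k \<otimes> inv h)"
          using quotient_mult[of "h \<otimes> g" h "inv (h \<otimes> k)"] h gD
          by (simp add: m_assoc inv_mult_group) (simp add: m_assoc[symmetric])
        then show ?thesis using gk h rep_mult[OF D_conj[OF h gD(1)] D_conj[OF h gD(2)]]
          by (simp add: core_def)
      qed
      then show ?thesis using gD D_subgroup by (simp add: core_def subgroup.m_closed)
    qed
  qed
  show "h \<otimes> g \<otimes> inv h \<in> core" if h: "h \<in> carrier G" and g: "g \<in> core" for h g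
  proof -
    have gD: "g \<in> D" "g \<in> carrier G" using g D_carrier by (auto simp: core_def)
    have "\<phi> (k \<otimes> (h \<otimes> g \<otimes> inv h) \<otimes> inv k) = id" if k: "k \<in> carrier G" for k
    proof -
      have "k \<otimes> (h \<otimes> g \<otimes> inv h) \<otimes> inv k = (k \<otimes> h) \<otimes> g \<otimes> inv (k \<otimes> h)"
        using conjugate_by_mult[OF k h gD(2)] by simp
      then show ?thesis using g h k by (simp add: core_def)
    qed
    then show ?thesis using D_conj[OF h gD(1)] by (simp add: core_def)
  qed
qed

text \<open>
  Each \<open>h\<close> is an element of the commutator subgroup times a power of \<open>s j\<close>, and conjugation by such powers does not change \<open>g\<close>.
\<close>

lemma conjugate_by_commutator_element:
  assumes g: "g \<in> D" and j: "1 \<le> j" "j < n" and gj: "g \<otimes> s j = s j \<otimes> g"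
    and h: "h \<in> carrier G"
  shows "\<exists>k\<in>D. h \<otimes> g \<otimes> inv h = k \<otimes> g \<otimes> inv k"
proof -
  have gC: "g \<in> carrier G" and jC: "s j \<in> carrier G" using g D_carrier j closed by auto
  have mD: "x \<otimes> y \<in> D" if "x \<in> D" "y \<in> D" for x y using that D_subgroup subgroup.m_closed by metis
  have "h \<in> generate G (s ` {1..<n})" using h gen by simp
  then show ?thesis
  proof induction
    case one
    show ?case using subgroup.one_closed[OF D_subgroup] by blast
  next
    case (incl h)
    then obtain i where i: "h = s i" "1 \<le> i" "i < n" by auto
    have C: "s i \<in> carrier G" using i closed by simp
    let ?k = "s i \<otimes> inv s j"
    have "s i = ?k \<otimes> s j" using C jC by (simp add: m_assoc)
    then have "h \<otimes> g \<otimes> inv h = ?k \<otimes> (s j \<otimes> g \<otimes> inv s j) \<otimes> inv ?k"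
      using conjugate_by_mult[of ?k "s j" g] C jC gC unfolding i(1) by (metis inv_closed m_closed)
    also have "s j \<otimes> g \<otimes> inv s j = g" using gj[symmetric] gC jC by (simp add: m_assoc)
    finally show ?case using quotient_in_D[OF i(2,3) j] by blast
  next
    case (inv h)
    then obtain i where i: "h = s i" "1 \<le> i" "i < n" by auto
    have C: "s i \<in> carrier G" using i closed by simp
    let ?k = "inv s i \<otimes> s j"
    have "inv s i \<otimes> (s j \<otimes> inv s i) \<otimes> inv (inv s i) \<in> D"
      using D_conj[of "inv s i"] quotient_in_D[OF j i(2,3)] C by simp
    then have kD: "?k \<in> D" using C jC by (simp add: m_assoc)
    have "inv s i = ?k \<otimes> inv s j" using C jC by (simp add: m_assoc)
    then have "inv h \<otimes> g \<otimes> inv (inv h) = ?k \<otimes> (inv s j \<otimes> g \<otimes> s j) \<otimes> inv ?k"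
      using conjugate_by_mult[of ?k "inv s j" g] C jC gC unfolding i(1) by (metis inv_closed inv_inv m_closed)
    also have "inv s j \<otimes> g \<otimes> s j = g"
      using commute_inv[OF jC gC gj[symmetric]] gC jC by (simp add: m_assoc)
    finally show ?case using kD by blast
  next
    case (eng h1 h2)
    then obtain k1 k2 where k: "k1 \<in> D" "h1 \<otimes> g \<otimes> inv h1 = k1 \<otimes> g \<otimes> inv k1"
        "k2 \<in> D" "h2 \<otimes> g \<otimes> inv h2 = k2 \<otimes> g \<otimes> inv k2" by blast
    have C: "h1 \<in> carrier G" "h2 \<in> carrier G" "k1 \<in> carrier G" "k2 \<in> carrier G"
      using eng gen k D_carrier by auto
    let ?c = "h1 \<otimes> k2 \<otimes> inv h1"
    have "(h1 \<otimes> h2) \<otimes> g \<otimes> inv (h1 \<otimes> h2) = h1 \<otimes> (h2 \<otimes> g \<otimes> inv h2) \<otimes> inv h1"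
      using C gC by (intro conjugate_by_mult)
    also have "\<dots> = h1 \<otimes> (k2 \<otimes> g \<otimes> inv k2) \<otimes> inv h1" by (simp only: k)
    also have "\<dots> = ?c \<otimes> (h1 \<otimes> g \<otimes> inv h1) \<otimes> inv ?c"
    proof -
      have "inv h1 \<otimes> (h1 \<otimes> x) = x" if "x \<in> carrier G" for x
        using that C by (simp add: m_assoc[symmetric])
      then show ?thesis using C gC by (simp add: m_assoc inv_mult_group)
    qed
    also have "\<dots> = ?c \<otimes> (k1 \<otimes> g \<otimes> inv k1) \<otimes> inv ?c" by (simp only: k)
    also have "\<dots> = (?c \<otimes> k1) \<otimes> g \<otimes> inv (?c \<otimes> k1)"
      using C gC by (intro conjugate_by_mult[symmetric]) auto
    finally show ?case using mD[OF D_conj[OF C(1) k(3)] k(1)] by blast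
  qed
qed

text \<open>
  This is how a single trivially acting element yields a relation in the quotient by the core.
\<close>

lemma core_if_commutes_with_generator:
  assumes g: "g \<in> D" "\<phi> g = id" and j: "1 \<le> j" "j < n" "g \<otimes> s j = s j \<otimes> g"
  shows "g \<in> core"
  unfolding core_def
proof (intro CollectI conjI ballI)
  fix h assume "h \<in> carrier G"
  then obtain k where k: "k \<in> D" "h \<otimes> g \<otimes> inv h = k \<otimes> g \<otimes> inv k"
    using conjugate_by_commutator_element[OF g(1) j] by blast
  have "inv k \<in> D" "k \<otimes> g \<in> D"
    using k(1) g(1) D_subgroup subgroup.m_inv_closed subgroup.m_closed by metis+
  then have "\<phi> (k \<otimes> g \<otimes> inv k) = \<phi> k \<circ> \<phi> g \<circ> \<phi> (inv k)"
    using rep_mult k(1) g(1) by simp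
  then show "\<phi> (h \<otimes> g \<otimes> inv h) = id" using k g(2) rep_inv_right by simp
qed (rule g)

abbreviation Q where "Q \<equiv> G Mod core"
abbreviation t where "t i \<equiv> core #> s i"

lemma t_family: "braid_family Q t n"
  using hom_image[OF normal.factorgroup_is_group[OF core_normal] normal.r_coset_hom_Mod[OF core_normal]] .

lemma trivial_if_adjacent_t_equal:
  assumes "1 \<le> i" "i + 1 < n" "t i = t (i + 1)" "g \<in> D"
  shows "\<phi> g = id"
proof -
  have "g \<in> core" using derived_le_normal[OF core_normal assms(1-3)] assms(4) by (rule subsetD)
  then have "\<phi> (\<one> \<otimes> g \<otimes> inv \<one>) = id" unfolding core_def using one_closed by blast
  then show ?thesis using D_carrier[OF assms(4)] by simp
qed

lemma coset_eqI:
  assumes C: "x \<in> carrier G" "y \<in> carrier G" and xy: "x \<otimes> inv y \<in> D" "\<phi> (x \<otimes> inv y) = id"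
    and j: "1 \<le> j" "j < n" and xj: "x \<otimes> s j = s j \<otimes> x" and yj: "y \<otimes> s j = s j \<otimes> y"
  shows "core #> x = core #> y"
proof -
  have jC: "s j \<in> carrier G" using j closed by simp
  have "(x \<otimes> inv y) \<otimes> s j = s j \<otimes> (x \<otimes> inv y)"
    using C jC xj commute_inv[OF C(2) jC yj] by (intro commute_mult) auto
  then have "x \<otimes> inv y \<in> core" using core_if_commutes_with_generator[OF xy j] by blast
  then show ?thesis using rcos_eq_iff[OF normal_imp_subgroup[OF core_normal] C] by simp
qed

end

section \<open>Six and seven strands\<close>

context braid_rep
begin

lemma quotient_rep_eq_iff:
  assumes "1 \<le> i" "i < n" "1 \<le> j" "j < n" "1 \<le> c" "c < n"
  shows "\<phi> (s i \<otimes> inv s c) = \<phi> (s j \<otimes> inv s c) \<longleftrightarrow> \<phi> (s i \<otimes> inv s j) = id"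
proof -
  have C: "s i \<in> carrier G" "s j \<in> carrier G" "s c \<in> carrier G" using assms closed by auto
  have "(s i \<otimes> inv s c) \<otimes> inv (s j \<otimes> inv s c) = s i \<otimes> inv s j"
    using C by (simp add: quotient_inv quotient_mult)
  then show ?thesis
    using rep_quotient_eq_id_iff[OF quotient_in_D quotient_in_D, of i c j c] assms by metis
qed

lemma rep_commute:
  assumes "g \<in> D" "h \<in> D" "g \<otimes> h = h \<otimes> g"
  shows "\<phi> g \<circ> \<phi> h = \<phi> h \<circ> \<phi> g"
  using assms rep_mult by metis

lemma rep_twisted_commute:
  assumes "1 \<le> i" "i < n" "1 \<le> j" "j < n" "1 \<le> c" "c < n"
    and "s i \<otimes> s j = s j \<otimes> s i" "s i \<otimes> s c = s c \<otimes> s i" "s j \<otimes> s c = s c \<otimes> s j"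
  shows "\<phi> (s i \<otimes> inv s c) \<circ> \<phi> (s j \<otimes> inv s c) = \<phi> (s j \<otimes> inv s c) \<circ> \<phi> (s i \<otimes> inv s c)"
  by (rule rep_commute) (use assms closed quotient_in_D twisted_commute in auto)

lemma rep_twisted_braid:
  assumes "1 \<le> i" "j < n" "j = i + 1" "1 \<le> c" "c < n"
    and "s i \<otimes> s c = s c \<otimes> s i" "s j \<otimes> s c = s c \<otimes> s j"
  shows "\<phi> (s i \<otimes> inv s c) \<circ> \<phi> (s j \<otimes> inv s c) \<circ> \<phi> (s i \<otimes> inv s c)
    = \<phi> (s j \<otimes> inv s c) \<circ> \<phi> (s i \<otimes> inv s c) \<circ> \<phi> (s j \<otimes> inv s c)"
proof -
  have C: "s i \<in> carrier G" "s j \<in> carrier G" "s c \<in> carrier G" using assms closed by auto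
  have X: "s i \<otimes> inv s c \<in> D" and Y: "s j \<otimes> inv s c \<in> D"
    using assms quotient_in_D by auto
  have br: "s i \<otimes> s j \<otimes> s i = s j \<otimes> s i \<otimes> s j" using braid assms by simp
  have M: "x \<otimes> y \<in> D" if "x \<in> D" "y \<in> D" for x y using that D_subgroup subgroup.m_closed by metis
  have triple: "\<phi> (x \<otimes> y \<otimes> z) = \<phi> x \<circ> \<phi> y \<circ> \<phi> z" if "x \<in> D" "y \<in> D" "z \<in> D" for x y z
    using that rep_mult M by metis
  show ?thesis
    using arg_cong[OF twisted_braid[OF C br assms(6,7)], of \<phi>]
    unfolding triple[OF X Y X] triple[OF Y X Y] .
qed

lemma t_eq_if_rep_quotient_trivial:
  assumes "1 \<le> i" "i < n" "1 \<le> j" "j < n" and "\<phi> (s i \<otimes> inv s j) = id"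
    and "1 \<le> k" "k < n" "s i \<otimes> s k = s k \<otimes> s i" "s j \<otimes> s k = s k \<otimes> s j"
  shows "t i = t j"
  using assms by (intro coset_eqI[of _ _ k]) (auto simp: closed quotient_in_D)

lemma trivial_if_adjacent_quotient_trivial:
  assumes "1 \<le> i" "i + 1 < n" and "j = i + 1" "\<phi> (s i \<otimes> inv s j) = id"
    and "1 \<le> k" "k < n" "k + 2 \<le> i \<or> i + 3 \<le> k" and "g \<in> D"
  shows "\<phi> g = id"
proof (rule trivial_if_adjacent_t_equal[OF assms(1,2) _ assms(8)])
  show "t i = t (i + 1)"
    by (rule t_eq_if_rep_quotient_trivial[of _ _ k]) (use assms far' in auto)
qed

text \<open>
  If far generators \<open>s i\<close> and \<open>s j\<close> agree in the quotient, then a neighbour of \<open>s j\<close> that is far from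
  \<open>s i\<close> commutes with \<open>s j\<close> there, and so equals it.
\<close>

lemma trivial_if_far_quotient_trivial:
  assumes ij: "1 \<le> i" "i < n" "1 \<le> j" "j < n" "\<phi> (s i \<otimes> inv s j) = id" "s i \<otimes> s j = s j \<otimes> s i"
    and k: "1 \<le> k" "k + 1 < n" "j = k \<and> (i + 2 \<le> k + 1 \<or> k + 3 \<le> i) \<or> j = k + 1 \<and> (i + 2 \<le> k \<or> k + 2 \<le> i)"
    and g: "g \<in> D"
  shows "\<phi> g = id"
proof (rule trivial_if_adjacent_t_equal[OF k(1,2) _ g])
  interpret F: braid_family Q t n by (rule t_family)
  have eq: "t i = t j"
    by (rule t_eq_if_rep_quotient_trivial[of _ _ i]) (use ij in auto)
  have f: "t u \<otimes>\<^bsub>Q\<^esub> t v = t v \<otimes>\<^bsub>Q\<^esub> t u" if "1 \<le> u" "u < n" "1 \<le> v" "v < n" "u + 2 \<le> v \<or> v + 2 \<le> u" for u v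
    using F.far[of u v] F.far[of v u] that by auto
  show "t k = t (k + 1)"
  proof (rule F.adjacent_eq_if_commuting[OF k(1,2)])
    show "t k \<otimes>\<^bsub>Q\<^esub> t (k + 1) = t (k + 1) \<otimes>\<^bsub>Q\<^esub> t k"
      using k(3)
    proof
      assume j: "j = k \<and> (i + 2 \<le> k + 1 \<or> k + 3 \<le> i)"
      then have "t i \<otimes>\<^bsub>Q\<^esub> t (k + 1) = t (k + 1) \<otimes>\<^bsub>Q\<^esub> t i"
        using ij k(1,2) by (intro f) auto
      then show ?thesis using eq j by argo
    next
      assume j: "j = k + 1 \<and> (i + 2 \<le> k \<or> k + 2 \<le> i)"
      then have "t k \<otimes>\<^bsub>Q\<^esub> t i = t i \<otimes>\<^bsub>Q\<^esub> t k"
        using ij k(1,2) by (intro f) auto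
      then show ?thesis using eq j by metis
    qed
  qed
qed

text \<open>
  Among the even permutations of at most five points, the centralizer of \<open>y = a \<circ> c\<close> is abelian unless \<open>y\<close> is trivial; it contains
  \<open>a\<close> and the ribbon move \<open>d\<close>, which conjugates \<open>a\<close> to \<open>c\<close>. If \<open>y\<close> is trivial, then
  \<open>s\<^sub>1 s\<^sub>3 = s\<^sub>5\<^sup>2\<close> holds in the quotient by the core, as \<open>s\<^sub>1\<close> commutes with both sides.
\<close>

lemma trivial_six_strands:
  assumes n: "n = 6" and X: "card X < n" and g: "g \<in> D"
  shows "\<phi> g = id"
proof -
  define a b c where "a = \<phi> (s 1 \<otimes> inv s 5)" and "b = \<phi> (s 2 \<otimes> inv s 5)"
    and "c = \<phi> (s 3 \<otimes> inv s 5)"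
  have perm: "a permutes X" "b permutes X" "c permutes X"
    and even: "sign a = 1" "sign b = 1" "sign c = 1"
    unfolding a_def b_def c_def using n quotient_in_D rep_permutes rep_even by auto
  have ac: "a \<circ> c = c \<circ> a"
    unfolding a_def c_def using n by (intro rep_twisted_commute far') auto
  have aba: "a \<circ> b \<circ> a = b \<circ> a \<circ> b"
    unfolding a_def b_def using n by (intro rep_twisted_braid far') auto
  have bcb: "b \<circ> c \<circ> b = c \<circ> b \<circ> c"
    unfolding b_def c_def using n by (intro rep_twisted_braid far') auto
  define y where "y = a \<circ> c"
  define d where "d = b \<circ> a \<circ> c \<circ> b"
  have ac': "a (c x) = c (a x)" and aba': "a (b (a x)) = b (a (b x))"
    and bcb': "b (c (b x)) = c (b (c x))" for x
    using ac aba bcb by (auto simp: fun_eq_iff)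
  have da: "d \<circ> a = c \<circ> d"
  proof
    fix x
    have "(d \<circ> a) x = b (c (a (b (a x))))" by (simp add: d_def ac')
    also have "\<dots> = c (b (c (a (b x))))" by (simp only: aba' bcb')
    also have "\<dots> = (c \<circ> d) x" by (simp add: d_def ac')
    finally show "(d \<circ> a) x = (c \<circ> d) x" .
  qed
  have dc: "d \<circ> c = a \<circ> d"
  proof
    fix x
    have "(d \<circ> c) x = b (a (c (b (c x))))" by (simp add: d_def)
    also have "\<dots> = a (b (a (c (b x))))" by (simp only: aba' bcb'[symmetric])
    finally show "(d \<circ> c) x = (a \<circ> d) x" by (simp add: d_def)
  qed
  show ?thesis
  proof (cases "y = id")
    case True
    have C: "s 1 \<in> carrier G" "s 3 \<in> carrier G" "s 5 \<in> carrier G" using n closed by auto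
    have e: "(s 1 \<otimes> inv s 5) \<otimes> (s 3 \<otimes> inv s 5) = (s 1 \<otimes> s 3) \<otimes> inv (s 5 \<otimes> s 5)"
      using C far[of 3 5] n by (intro twisted_mult) auto
    have q: "s 1 \<otimes> inv s 5 \<in> D" "s 3 \<otimes> inv s 5 \<in> D" using quotient_in_D n by auto
    have inD: "(s 1 \<otimes> s 3) \<otimes> inv (s 5 \<otimes> s 5) \<in> D"
      using subgroup.m_closed[OF D_subgroup q] e by simp
    have triv: "\<phi> ((s 1 \<otimes> s 3) \<otimes> inv (s 5 \<otimes> s 5)) = id"
      using rep_mult[OF q] e True by (simp add: y_def a_def c_def)
    have "core #> (s 1 \<otimes> s 3) = core #> (s 5 \<otimes> s 5)"
      by (rule coset_eqI[of _ _ 1, OF _ _ inD triv])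
        (use C n far[of 1 3] far[of 1 5] in \<open>auto intro!: commute_mult\<close>)
    then have "t 1 \<otimes>\<^bsub>Q\<^esub> t 3 = t 5 \<otimes>\<^bsub>Q\<^esub> t 5"
      using normal.rcos_sum[OF core_normal] C by simp
    then have "t 2 = t 3"
      using braid_family.generator_collapse_of_square_relation[OF t_family] n by simp
    then have "t 2 = t (2 + 1)" by simp
    then show ?thesis using trivial_if_adjacent_t_equal[of 2] n g by simp
  next
    case False
    have yX: "y permutes X" "sign y = 1" unfolding y_def
      using permutes_compose[OF perm(3,1)] sign_comp_permutes[OF rep.finite perm(1,3)] even by auto
    have dX: "d permutes X" unfolding d_def using perm by (intro permutes_compose)
    have sd: "sign d = 1" unfolding d_def
      using perm even by (simp add: sign_comp_permutes[OF rep.finite] permutes_compose)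
    have "a \<circ> d = d \<circ> a"
    proof (rule even_centralizer_commute[OF rep.finite _ yX False _ perm(1) even(1) _ dX sd])
      show "card X \<le> 6" "card X \<le> 5 \<or> y \<circ> y \<noteq> id" using X n by auto
      show "a \<circ> y = y \<circ> a" unfolding y_def by (simp add: fun_eq_iff ac')
      show "d \<circ> y = y \<circ> d" unfolding y_def using da dc by (metis ac comp_assoc)
    qed
    then have "(a \<circ> d) \<circ> inv' d = (c \<circ> d) \<circ> inv' d" using da by simp
    then have "a = c" using permutes_inv_o(1)[OF dX] by (simp add: comp_assoc)
    then have "\<phi> (s 1 \<otimes> inv s 3) = id"
      using quotient_rep_eq_iff[of 1 3 5] n by (simp add: a_def c_def)
    then show ?thesis
      using trivial_if_far_quotient_trivial[of 1 3 3 g] n far[of 1 3] g by simp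
  qed
qed

text \<open>
  Among the even permutations of at most six points, elements with nontrivial square have abelian
  centralizers.
  The noncommuting \<open>a\<close> and \<open>b\<close> force \<open>x\<close>, and with it its conjugate \<open>w\<close>, to be an involution.
  Two distinct involutions satisfying the braid relation generate a dihedral group of order six, in which \<open>u = x \<circ> w\<close> is the
  rotation. So the centralizer of \<open>u\<close> is abelian, and \<open>s\<^sub>4 s\<^sub>6\<^sup>-\<^sup>1\<close> commutes with
  \<open>s\<^sub>5 s\<^sub>4\<^sup>-\<^sup>1\<close> in the quotient by the core, which identifies \<open>s\<^sub>4\<close> with \<open>s\<^sub>6\<close>.
\<close>

lemma trivial_seven_strands:
  assumes n: "n = 7" and X: "card X < n" and g: "g \<in> D"
  shows "\<phi> g = id"
proof (rule ccontr)
  assume nontriv: "\<phi> g \<noteq> id"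
  have cX: "card X \<le> 6" using X n by simp
  define x w where "x = \<phi> (s 1 \<otimes> inv s 6)" and "w = \<phi> (s 2 \<otimes> inv s 6)"
  define a b where "a = \<phi> (s 3 \<otimes> inv s 6)" and "b = \<phi> (s 4 \<otimes> inv s 6)"
  have perm: "x permutes X" "w permutes X" "a permutes X" "b permutes X"
    and even: "sign x = 1" "sign w = 1" "sign a = 1" "sign b = 1"
    unfolding x_def w_def a_def b_def using n quotient_in_D rep_permutes rep_even by auto
  have xne: "x \<noteq> id"
    using trivial_if_far_quotient_trivial[of 1 6 5 g] n far[of 1 6] g nontriv unfolding x_def by auto
  have xa: "a \<circ> x = x \<circ> a"
    unfolding a_def x_def using n by (intro rep_twisted_commute far') auto
  have xb: "b \<circ> x = x \<circ> b"
    unfolding b_def x_def using n by (intro rep_twisted_commute far') auto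
  have aba: "a \<circ> b \<circ> a = b \<circ> a \<circ> b"
    unfolding a_def b_def using n by (intro rep_twisted_braid far') auto
  have "a \<noteq> b"
  proof
    assume "a = b"
    then have triv: "\<phi> (s 3 \<otimes> inv s 4) = id"
      using quotient_rep_eq_iff[of 3 4 6] n by (simp add: a_def b_def)
    have "\<phi> g = id"
      by (rule trivial_if_adjacent_quotient_trivial[OF _ _ _ triv, of 1]) (simp_all add: n g)
    then show False using nontriv by contradiction
  qed
  have "a \<circ> b \<noteq> b \<circ> a"
  proof
    assume ab: "a \<circ> b = b \<circ> a"
    have "a p = b p" for p
    proof -
      have "a (b (a p)) = b (a (b p))" "a (b (b p)) = b (a (b p))"
        using aba ab by (auto simp: fun_eq_iff)
      then have "a (b (a p)) = a (b (b p))" by simp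
      then show ?thesis using permutes_inj[OF perm(3)] permutes_inj[OF perm(4)] by (auto dest: injD)
    qed
    then have "a = b" by blast
    then show False using \<open>a \<noteq> b\<close> by simp
  qed
  then have xx: "x \<circ> x = id"
    using even_centralizer_commute[OF rep.finite cX perm(1) even(1) xne _ perm(3) even(3) xa perm(4) even(4) xb]
    by blast
  have xwx: "x \<circ> w \<circ> x = w \<circ> x \<circ> w"
    unfolding x_def w_def using n by (intro rep_twisted_braid far') auto
  have xx': "x (x p) = p" and xwx': "x (w (x p)) = w (x (w p))" for p
    using xx xwx by (auto simp: fun_eq_iff)
  have ww': "w (w p) = p" for p
  proof -
    \<comment> \<open>Every point has this form, so it suffices to compute there with the braid relation.\<close>
    define q where "q = inv' w (inv' x p)"
    have q: "p = x (w q)"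
      using permutes_inverses(1)[OF perm(1)] permutes_inverses(1)[OF perm(2)] by (simp add: q_def)
    have "w (w (x (w q))) = w (x (w (x q)))" by (simp only: xwx')
    also have "\<dots> = x (w (x (x q)))" by (simp only: xwx')
    finally have "w (w (x (w q))) = x (w q)" by (simp only: xx')
    then show ?thesis by (simp only: flip: q)
  qed
  define u where "u = \<phi> (s 1 \<otimes> inv s 2)"
  have C: "s i \<in> carrier G" if "1 \<le> i" "i \<le> 6" for i using that n closed by simp
  have qD: "s i \<otimes> inv s j \<in> D" if "1 \<le> i" "i \<le> 6" "1 \<le> j" "j \<le> 6" for i j
    using that n quotient_in_D by simp
  have "s 1 \<otimes> inv s 6 = (s 1 \<otimes> inv s 2) \<otimes> (s 2 \<otimes> inv s 6)"
    using C by (intro quotient_mult[symmetric]) auto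
  then have "x = u \<circ> w" using rep_mult qD by (simp add: x_def u_def w_def)
  then have u: "u p = x (w p)" for p using ww' by simp
  have uX: "u permutes X" "sign u = 1" unfolding u_def using rep_permutes rep_even qD by auto
  have une: "u \<noteq> id"
    using trivial_if_adjacent_quotient_trivial[of 1 2 4 g] n g nontriv unfolding u_def by auto
  have u3: "u (u (u p)) = p" for p
  proof -
    have "u (u (u p)) = x (w (x (w (x (w p)))))" by (simp only: u)
    also have "\<dots> = w (x (w (w (x (w p)))))" by (rule xwx')
    finally show ?thesis by (simp only: ww' xx')
  qed
  \<comment> \<open>The rotation has order three, so its square is nontrivial as well.\<close>
  have uu: "u \<circ> u \<noteq> id"
    using une u3 by (auto simp: fun_eq_iff) metis
  define P R where "P = \<phi> (s 4 \<otimes> inv s 6)" and "R = \<phi> (s 5 \<otimes> inv s 4)"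
  have PR: "P permutes X" "sign P = 1" "R permutes X" "sign R = 1"
    unfolding P_def R_def using rep_permutes rep_even qD by auto
  have comm_u: "\<phi> (s i \<otimes> inv s j) \<circ> u = u \<circ> \<phi> (s i \<otimes> inv s j)"
    if ij: "4 \<le> i" "i \<le> 6" "4 \<le> j" "j \<le> 6" for i j
    unfolding u_def
  proof (rule rep_commute)
    have f: "s k \<otimes> s l = s l \<otimes> s k" if "4 \<le> k" "k \<le> 6" "1 \<le> l" "l \<le> 2" for k l
      using far'[of k l] that n by auto
    have q: "(s i \<otimes> inv s j) \<otimes> s l = s l \<otimes> (s i \<otimes> inv s j)" if "1 \<le> l" "l \<le> 2" for l
      using that ij C f commute_inv[of "s j" "s l"] by (intro commute_mult) auto
    have "inv s 2 \<otimes> (s i \<otimes> inv s j) = (s i \<otimes> inv s j) \<otimes> inv s 2"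
      using ij C q by (intro commute_inv) auto
    then show "(s i \<otimes> inv s j) \<otimes> (s 1 \<otimes> inv s 2) = (s 1 \<otimes> inv s 2) \<otimes> (s i \<otimes> inv s j)"
      using commute_mult[of "s 1" "inv s 2" "s i \<otimes> inv s j"] ij C q[of 1] by simp
  qed (use ij qD in auto)
  have "P \<circ> R = R \<circ> P"
    using comm_u[of 4 6] comm_u[of 5 4] unfolding P_def[symmetric] R_def[symmetric]
    by (intro even_centralizer_commute[OF rep.finite cX uX une disjI2[OF uu] PR(1,2) _ PR(3,4)]) simp_all
  then have e: "\<phi> ((s 5 \<otimes> inv s 4) \<otimes> (s 4 \<otimes> inv s 6)) = \<phi> ((s 4 \<otimes> inv s 6) \<otimes> (s 5 \<otimes> inv s 4))"
    using rep_mult qD by (simp add: P_def R_def)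
  interpret F: braid_family Q t n by (rule t_family)
  interpret N: normal core G by (rule core_normal)
  interpret h: group_hom G Q "(#>) core"
    using N.r_coset_hom_Mod F.group_axioms is_group by (simp add: group_hom_def group_hom_axioms_def)
  note [simp del] = one_FactGroup mult_FactGroup
  have tC: "t i \<in> carrier Q" if "1 \<le> i" "i \<le> 6" for i using that n F.closed by simp
  have "core #> ((s 5 \<otimes> inv s 4) \<otimes> (s 4 \<otimes> inv s 6)) = core #> ((s 4 \<otimes> inv s 6) \<otimes> (s 5 \<otimes> inv s 4))"
  proof (rule coset_eqI[of _ _ 1])
    have m: "(s 5 \<otimes> inv s 4) \<otimes> (s 4 \<otimes> inv s 6) \<in> D" "(s 4 \<otimes> inv s 6) \<otimes> (s 5 \<otimes> inv s 4) \<in> D"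
      using qD D_subgroup by (simp_all add: subgroup.m_closed)
    then show "(s 5 \<otimes> inv s 4) \<otimes> (s 4 \<otimes> inv s 6) \<in> carrier G"
      "(s 4 \<otimes> inv s 6) \<otimes> (s 5 \<otimes> inv s 4) \<in> carrier G" using D_carrier by auto
    show "(s 5 \<otimes> inv s 4) \<otimes> (s 4 \<otimes> inv s 6) \<otimes> inv ((s 4 \<otimes> inv s 6) \<otimes> (s 5 \<otimes> inv s 4)) \<in> D"
      using m D_subgroup by (simp add: subgroup.m_closed subgroup.m_inv_closed)
    show "\<phi> ((s 5 \<otimes> inv s 4) \<otimes> (s 4 \<otimes> inv s 6) \<otimes> inv ((s 4 \<otimes> inv s 6) \<otimes> (s 5 \<otimes> inv s 4))) = id"
      using rep_quotient_eq_id_iff[OF m] e by simp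
    have f: "s k \<otimes> s 1 = s 1 \<otimes> s k" "inv s k \<otimes> s 1 = s 1 \<otimes> inv s k" if "4 \<le> k" "k \<le> 6" for k
      using far'[of k 1] commute_inv[of "s k" "s 1"] C that n by auto
    show "(s 5 \<otimes> inv s 4) \<otimes> (s 4 \<otimes> inv s 6) \<otimes> s 1 = s 1 \<otimes> ((s 5 \<otimes> inv s 4) \<otimes> (s 4 \<otimes> inv s 6))"
      "(s 4 \<otimes> inv s 6) \<otimes> (s 5 \<otimes> inv s 4) \<otimes> s 1 = s 1 \<otimes> ((s 4 \<otimes> inv s 6) \<otimes> (s 5 \<otimes> inv s 4))"
      using f C by (intro commute_mult m_closed inv_closed; simp)+
  qed (use n in auto)
  then have Q1: "(t 5 \<otimes>\<^bsub>Q\<^esub> inv\<^bsub>Q\<^esub> t 4) \<otimes>\<^bsub>Q\<^esub> (t 4 \<otimes>\<^bsub>Q\<^esub> inv\<^bsub>Q\<^esub> t 6)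
      = (t 4 \<otimes>\<^bsub>Q\<^esub> inv\<^bsub>Q\<^esub> t 6) \<otimes>\<^bsub>Q\<^esub> (t 5 \<otimes>\<^bsub>Q\<^esub> inv\<^bsub>Q\<^esub> t 4)"
    using C by (simp add: h.hom_mult h.hom_inv)
  have "t 4 = t 6"
  proof (rule F.braided_reversal_eq[of _ "t 5"])
    show c46: "t 4 \<otimes>\<^bsub>Q\<^esub> t 6 = t 6 \<otimes>\<^bsub>Q\<^esub> t 4" using F.far[of 4 6] n by simp
    show "t 4 \<otimes>\<^bsub>Q\<^esub> t 5 \<otimes>\<^bsub>Q\<^esub> t 4 = t 5 \<otimes>\<^bsub>Q\<^esub> t 4 \<otimes>\<^bsub>Q\<^esub> t 5" using F.braid[of 4] n by simp
    show "t 5 \<otimes>\<^bsub>Q\<^esub> t 6 \<otimes>\<^bsub>Q\<^esub> t 5 = t 6 \<otimes>\<^bsub>Q\<^esub> t 5 \<otimes>\<^bsub>Q\<^esub> t 6" using F.braid[of 5] n by simp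
    show "t 6 \<otimes>\<^bsub>Q\<^esub> t 5 \<otimes>\<^bsub>Q\<^esub> t 4 = t 4 \<otimes>\<^bsub>Q\<^esub> t 5 \<otimes>\<^bsub>Q\<^esub> t 6"
      by (rule F.reversal_if_quotients_commute[OF _ _ _ c46 Q1]) (use tC in auto)
  qed (use tC in auto)
  then have "t 3 \<otimes>\<^bsub>Q\<^esub> t 4 = t 4 \<otimes>\<^bsub>Q\<^esub> t 3" using F.far[of 3 6] n by simp
  then have "t 3 = t (3 + 1)" using F.adjacent_eq_if_commuting[of 3] n by simp
  then show False using trivial_if_adjacent_t_equal[of 3] n g nontriv by simp
qed

end

section \<open>Induction on the number of strands\<close>

lemma (in group) generate_commute:
  assumes "S \<subseteq> carrier G" "z \<in> carrier G" "\<And>x. x \<in> S \<Longrightarrow> x \<otimes> z = z \<otimes> x"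
    and "h \<in> generate G S"
  shows "h \<otimes> z = z \<otimes> h"
  using assms(4)
proof induction
  case one
  show ?case using assms(2) by simp
next
  case (incl h)
  then show ?case by (rule assms(3))
next
  case (inv h)
  then show ?case using assms(1-3) by (intro commute_inv) auto
next
  case (eng h1 h2)
  then show ?case using assms(1,2) generate_in_carrier by (intro commute_mult) auto
qed

context braid_generated
begin

abbreviation segment where "segment m \<equiv> G\<lparr>carrier := generate G (s ` {1..<m})\<rparr>"

lemma segment_generated:
  assumes "5 \<le> m" "m \<le> n"
  shows "braid_generated (segment m) s m"
proof -
  have S: "s ` {1..<m} \<subseteq> carrier G" using assms closed by auto
  have H: "subgroup (generate G (s ` {1..<m})) G" using S by (rule generate_is_subgroup)
  have inH: "s ` {1..<m} \<subseteq> generate G (s ` {1..<m})" by (auto intro: generate.incl)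
  interpret H: group "segment m" by (rule subgroup.subgroup_is_group[OF H is_group])
  show ?thesis
  proof
    show "carrier (segment m) = generate (segment m) (s ` {1..<m})"
      using generate_consistent[OF inH H] by simp
    show "s i \<in> carrier (segment m)" if "1 \<le> i" "i < m" for i
      using that inH by auto
    show "s i \<otimes>\<^bsub>segment m\<^esub> s j = s j \<otimes>\<^bsub>segment m\<^esub> s i"
      if "1 \<le> i" "i + 2 \<le> j" "j < m" for i j
      using far[of i j] that assms by simp
    show "s i \<otimes>\<^bsub>segment m\<^esub> s (i + 1) \<otimes>\<^bsub>segment m\<^esub> s i
        = s (i + 1) \<otimes>\<^bsub>segment m\<^esub> s i \<otimes>\<^bsub>segment m\<^esub> s (i + 1)"
      if "1 \<le> i" "i + 1 < m" for i
      using braid[of i] that assms by simp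
  qed (rule assms)
qed

lemma segment_commutator_le:
  assumes "m \<le> n"
  shows "derived (segment m) (carrier (segment m)) \<subseteq> D"
proof -
  have S: "s ` {1..<m} \<subseteq> carrier G" using assms closed by auto
  have H: "subgroup (generate G (s ` {1..<m})) G" using S by (rule generate_is_subgroup)
  have "derived (segment m) (carrier (segment m)) = derived G (generate G (s ` {1..<m}))"
    using derived_consistent[OF subset_refl H] by simp
  also have "\<dots> \<subseteq> D" using mono_derived[of _ "carrier G"] subgroup.subset[OF H] by blast
  finally show ?thesis .
qed

end

text \<open>
  The commutator subgroup of the first \<open>n - 3\<close> strands moves all but at most two points, and
  \<open>s\<^sub>n\<^sub>-\<^sub>2 s\<^sub>n\<^sub>-\<^sub>1\<^sup>-\<^sup>1\<close> commutes with it. The bound \<open>n \<ge> 8\<close> makes \<open>n - 3\<close> at least five, as the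
  induction needs; \<open>card X < 2 * (n - 3)\<close> then holds automatically.
\<close>

lemma (in braid_rep) trivial_if_segment_acts_trivially_below:
  assumes n: "8 \<le> n" and X: "card X < n" and g: "g \<in> D"
    and below: "acts_trivially_below
      (segment (n - 3)\<lparr>carrier := derived (segment (n - 3)) (carrier (segment (n - 3)))\<rparr>) (n - 3)"
      (is "acts_trivially_below ?K' _")
  shows "\<phi> g = id"
proof (rule ccontr)
  assume nontriv: "\<phi> g \<noteq> id"
  let ?D' = "derived (segment (n - 3)) (carrier (segment (n - 3)))"
  interpret S: braid_generated "segment (n - 3)" s "n - 3"
    by (rule segment_generated) (use n in auto)
  have D'D: "h \<in> D" if "h \<in> ?D'" for h using segment_commutator_le[of "n - 3"] that by auto
  interpret R: perm_rep ?K' \<phi> X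
  proof (intro perm_rep.intro perm_rep_axioms.intro)
    show "group ?K'" by (rule S.K_group)
  qed (use rep.finite rep_permutes rep_mult D'D in auto)
  have qC: "s (n - 2) \<in> carrier G" "s (n - 1) \<in> carrier G" using n closed by auto
  have qD: "s (n - 2) \<otimes> inv s (n - 1) \<in> D" using n by (intro quotient_in_D) auto
  define c where "c = \<phi> (s (n - 2) \<otimes> inv s (n - 1))"
  have c: "c permutes X" "sign c = 1" unfolding c_def using qD rep_permutes rep_even by auto
  have comm: "\<phi> h \<circ> c = c \<circ> \<phi> h" if h: "h \<in> ?D'" for h
    unfolding c_def
  proof (rule rep_commute[OF D'D[OF h] qD])
    have hH: "h \<in> generate G (s ` {1..<n - 3})" using S.D_carrier[OF h] by simp
    have hC: "h \<in> carrier G" using D'D[OF h] D_carrier by simp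
    have q: "h \<otimes> s k = s k \<otimes> h" if k: "n - 2 \<le> k" "k < n" for k
    proof (rule generate_commute[OF _ _ _ hH])
      show "x \<otimes> s k = s k \<otimes> x" if "x \<in> s ` {1..<n - 3}" for x
      proof -
        obtain i where "x = s i" "1 \<le> i" "i < n - 3" using \<open>x \<in> s ` {1..<n - 3}\<close> by auto
        then show ?thesis using k far[of i k] by simp
      qed
    qed (use k n closed in auto)
    have 1: "s (n - 2) \<otimes> h = h \<otimes> s (n - 2)" using q[of "n - 2"] n by simp
    have "s (n - 1) \<otimes> h = h \<otimes> s (n - 1)" using q[of "n - 1"] n by simp
    then have 2: "inv s (n - 1) \<otimes> h = h \<otimes> inv s (n - 1)" using qC hC by (intro commute_inv) auto
    show "h \<otimes> (s (n - 2) \<otimes> inv s (n - 1)) = (s (n - 2) \<otimes> inv s (n - 1)) \<otimes> h"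
      using commute_mult[OF qC(1) inv_closed[OF qC(2)] hC 1 2] by simp
  qed
  define M where "M = {x \<in> X. \<exists>h\<in>?D'. \<phi> h x \<noteq> x}"
  have Minv: "\<phi> h x \<in> M" if h: "h \<in> carrier ?K'" and x: "x \<in> M" for h x
  proof -
    obtain k where k: "k \<in> ?D'" "\<phi> k x \<noteq> x" using x by (auto simp: M_def)
    have hD: "h \<in> ?D'" using h by simp
    let ?k = "h \<otimes>\<^bsub>?K'\<^esub> k \<otimes>\<^bsub>?K'\<^esub> inv\<^bsub>?K'\<^esub> h"
    have "\<phi> ?k = \<phi> h \<circ> \<phi> k \<circ> \<phi> (inv\<^bsub>?K'\<^esub> h)"
      using R.mult[of "h \<otimes>\<^bsub>?K'\<^esub> k" "inv\<^bsub>?K'\<^esub> h"] R.mult[of h k] h k R.m_closed[of h k] R.inv_closed[OF h]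
      by simp
    then have "\<phi> ?k (\<phi> h x) = \<phi> h (\<phi> k x)" using R.inv_left[OF h] by simp
    then have "\<phi> ?k (\<phi> h x) \<noteq> \<phi> h x" using k R.inj[OF h] by simp
    moreover have "?k \<in> carrier ?K'"
      using h k(1) by (intro R.m_closed R.inv_closed) simp_all
    then have "?k \<in> ?D'" by simp
    moreover have "\<phi> h x \<in> X" using R.in_image[OF h] x by (simp add: M_def)
    ultimately show ?thesis unfolding M_def by blast
  qed
  have "card M \<ge> n - 3"
  proof (rule ccontr)
    assume "\<not> n - 3 \<le> card M"
    then have "\<phi> h x = x" if "h \<in> carrier ?K'" "x \<in> M" for h x
      using R.fixes_invariant_subset[OF below _ _ Minv that] by (auto simp: M_def)
    then have "M = {}" by (auto simp: M_def)
    moreover have "s 1 \<otimes> inv s 2 \<in> ?D'"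
    proof -
      have "s 2 \<in> generate G (s ` {1..<n - 3})" using n by (intro generate.incl) auto
      moreover have "subgroup (generate G (s ` {1..<n - 3})) G"
        using closed n by (intro generate_is_subgroup) auto
      ultimately have "inv\<^bsub>segment (n - 3)\<^esub> s 2 = inv s 2" using m_inv_consistent by blast
      then show ?thesis using S.quotient_in_D[of 1 2] n by simp
    qed
    ultimately have "\<phi> (s 1 \<otimes> inv s 2) x = x" if "x \<in> X" for x using that by (auto simp: M_def)
    moreover have "\<phi> (s 1 \<otimes> inv s 2) x = x" if "x \<notin> X" for x
      using that rep_permutes[OF quotient_in_D[of 1 2]] permutes_not_in n by fastforce
    ultimately have triv: "\<phi> (s 1 \<otimes> inv s 2) = id" by (auto simp: fun_eq_iff)
    have "\<phi> g = id"
      by (rule trivial_if_adjacent_quotient_trivial[OF _ _ _ triv, of 4]) (use n g in auto)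
    then show False using nontriv by contradiction
  qed
  moreover have "M \<subseteq> X" by (auto simp: M_def)
  ultimately have "card (X - M) \<le> 2" using X rep.finite by (simp add: card_Diff_subset finite_subset)
  moreover have "c permutes (X - M)"
  proof (rule permutes_superset[OF c(1)])
    fix x assume "x \<in> X - (X - M)"
    then obtain h where h: "h \<in> ?D'" "\<phi> h x \<noteq> x" by (auto simp: M_def)
    have "c x \<noteq> x \<Longrightarrow> \<phi> h x = x"
      by (rule R.commuting_permutation_support_disjoint[OF S.commutator_subgroup_perfect below _ c(1)])
        (use n X comm h in auto)
    then show "c x = x" using h by blast
  qed
  ultimately have triv: "\<phi> (s (n - 2) \<otimes> inv s (n - 1)) = id"
    using even_permutation_two_points[of "X - M" c] c(2) rep.finite by (simp add: c_def)
  have "\<phi> g = id"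
    by (rule trivial_if_adjacent_quotient_trivial[OF _ _ _ triv, of 1]) (use n g in auto)
  then show False using nontriv by contradiction
qed

theorem commutator_subgroup_acts_trivially_below:
  fixes G :: "('a, 'b) monoid_scheme"
  assumes "braid_generated G s n"
  shows "acts_trivially_below (G\<lparr>carrier := derived G (carrier G)\<rparr>) n"
  using assms
proof (induction n arbitrary: G rule: less_induct)
  case (less n)
  interpret braid_generated G s n by fact
  show ?case
    unfolding acts_trivially_below_def
  proof (intro allI impI ballI, elim conjE)
    fix \<phi> :: "'a \<Rightarrow> nat \<Rightarrow> nat" and X g
    assume rep: "perm_rep K \<phi> X" and X: "card X < n" and g: "g \<in> carrier K"
    interpret braid_rep G s n \<phi> X
      using rep braid_generated_axioms by (simp add: braid_rep_def)
    have gD: "g \<in> D" using g by simp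
    consider "n = 5" | "n = 6" | "n = 7" | "8 \<le> n" using five by linarith
    then show "\<phi> g = id"
    proof cases
      case 1
      then show ?thesis
        using rep.perfect_trivial_on_four_points[OF commutator_subgroup_perfect _ g] X by simp
    next
      case 2
      then show ?thesis using trivial_six_strands X gD by blast
    next
      case 3
      then show ?thesis using trivial_seven_strands X gD by blast
    next
      case 4
      have "acts_trivially_below (segment (n - 3)
          \<lparr>carrier := derived (segment (n - 3)) (carrier (segment (n - 3)))\<rparr>) (n - 3)"
        by (rule less.IH) (use 4 segment_generated[of "n - 3"] in auto)
      then show ?thesis using trivial_if_segment_acts_trivially_below[OF 4 X gD] by blast
    qed
  qed
qed

section \<open>The braid groups\<close>

definition half_twist :: "nat \<Rightarrow> nat \<Rightarrow> (nat \<times> bool) list set" where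
  "half_twist n i = pres_class {1..<n} (braid_relations n) [(i, True)]"

lemma braid_generated_braid_group:
  assumes "5 \<le> n"
  shows "braid_generated (braid_group n) (half_twist n) n"
proof -
  define Y where "Y = {1..<n}"
  let ?R = "braid_relations n"
  let ?c = "pres_class Y ?R"
  interpret group "braid_group n" by (rule group_braid_group)
  have carr: "carrier (braid_group n) = ?c ` words Y"
    and one: "\<one>\<^bsub>braid_group n\<^esub> = ?c []"
    by (simp_all add: braid_group_def presented_group_def Y_def)
  have mult: "?c u \<otimes>\<^bsub>braid_group n\<^esub> ?c v = ?c (u @ v)" if "u \<in> words Y" "v \<in> words Y" for u v
    using presented_group_mult[OF that] by (simp add: braid_group_def Y_def)
  have inY: "i \<in> Y \<longleftrightarrow> 1 \<le> i \<and> i < n" for i by (simp add: Y_def)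
  have rel: "?c u = ?c v" if "(u, v) \<in> ?R" "u \<in> words Y" "v \<in> words Y" for u v
    using pres_rel[OF that] that(2) by (simp add: pres_class_eq_iff)
  have ht: "half_twist n i = ?c [(i, True)]" for i by (simp add: half_twist_def Y_def)
  have hC: "half_twist n i \<in> carrier (braid_group n)" if "i \<in> Y" for i
    unfolding carr ht using that by (intro imageI) simp
  have gen: "?c w \<in> generate (braid_group n) (half_twist n ` Y)" if "w \<in> words Y" for w
    using that
  proof (induction w)
    case Nil
    show ?case unfolding one[symmetric] by (rule generate.one)
  next
    case (Cons a w)
    obtain x b where a: "a = (x, b)" by (cases a)
    have x: "x \<in> Y" and w: "w \<in> words Y" using Cons.prems a by auto
    have "?c [(x, b)] \<in> generate (braid_group n) (half_twist n ` Y)"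
    proof (cases b)
      case True
      then show ?thesis using x by (intro generate.incl) (simp add: ht)
    next
      case False
      have "?c [(x, False)] \<otimes>\<^bsub>braid_group n\<^esub> half_twist n x = \<one>\<^bsub>braid_group n\<^esub>"
        unfolding ht one using x pres_cancel[OF x, of ?R False]
        by (simp add: mult pres_class_eq_iff)
      moreover have "?c [(x, False)] \<in> carrier (braid_group n)"
        unfolding carr using x by (intro imageI) simp
      ultimately have "inv\<^bsub>braid_group n\<^esub> half_twist n x = ?c [(x, False)]"
        using inv_equality hC[OF x] by blast
      then show ?thesis using generate.inv[of "half_twist n x" "half_twist n ` Y" "braid_group n"] x False
        by simp
    qed
    then have "?c [(x, b)] \<otimes>\<^bsub>braid_group n\<^esub> ?c w \<in> generate (braid_group n) (half_twist n ` Y)"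
      using Cons.IH[OF w] by (rule generate.eng)
    then show ?case using x w a by (simp add: mult)
  qed
  show ?thesis
  proof
    show "half_twist n i \<in> carrier (braid_group n)" if "1 \<le> i" "i < n" for i
      using that hC by (simp add: Y_def)
    show "half_twist n i \<otimes>\<^bsub>braid_group n\<^esub> half_twist n j = half_twist n j \<otimes>\<^bsub>braid_group n\<^esub> half_twist n i"
      if "1 \<le> i" "i + 2 \<le> j" "j < n" for i j
    proof -
      have "([(i, True), (j, True)], [(j, True), (i, True)]) \<in> ?R"
        using that unfolding braid_relations_def by blast
      then show ?thesis unfolding ht using that rel by (simp add: mult inY)
    qed
    show "half_twist n i \<otimes>\<^bsub>braid_group n\<^esub> half_twist n (i + 1) \<otimes>\<^bsub>braid_group n\<^esub> half_twist n i
        = half_twist n (i + 1) \<otimes>\<^bsub>braid_group n\<^esub> half_twist n i \<otimes>\<^bsub>braid_group n\<^esub> half_twist n (i + 1)"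
      if "1 \<le> i" "i + 1 < n" for i
    proof -
      have "([(i, True), (i + 1, True), (i, True)], [(i + 1, True), (i, True), (i + 1, True)]) \<in> ?R"
        using that unfolding braid_relations_def by blast
      then show ?thesis unfolding ht using that rel by (simp add: mult inY)
    qed
    show "carrier (braid_group n) = generate (braid_group n) (half_twist n ` {1..<n})"
      using gen generate_in_carrier[of "half_twist n ` Y"] hC unfolding carr Y_def[symmetric] by blast
  qed (rule assms)
qed

text \<open>
  A trivial action on the cosets fixes the coset \<open>H\<close>, whose stabilizer is \<open>H\<close>. The inverse turns right
  multiplication of right cosets into a left action.
\<close>

lemma (in group) subgroup_of_small_index_eq:
  assumes below: "acts_trivially_below G m" and H: "subgroup H G"
    and fin: "finite (rcosets H)" and small: "card (rcosets H) < m"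
  shows "H = carrier G"
proof -
  let ?\<psi> = "\<lambda>g C. if C \<in> rcosets H then C #> inv g else C"
  have HC: "H \<subseteq> carrier G" using H by (rule subgroup.subset)
  interpret R: perm_rep G ?\<psi> "rcosets H"
  proof (rule perm_rep_of_action[OF group_axioms fin])
    fix g C assume g: "g \<in> carrier G" and "C \<in> rcosets H"
    then obtain x where x: "x \<in> carrier G" "C = H #> x" by (auto simp: RCOSETS_def)
    then show "C #> inv g \<in> rcosets H"
      using g HC coset_mult_assoc[OF HC x(1), of "inv g"] by (auto simp: RCOSETS_def)
  next
    fix C assume "C \<in> rcosets H"
    then have "C \<subseteq> carrier G" using subgroup.rcosets_carrier[OF H is_group] by simp
    then show "C #> inv \<one> = C" by simp
  next
    fix g h C assume gh: "g \<in> carrier G" "h \<in> carrier G" and "C \<in> rcosets H"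
    then have "C \<subseteq> carrier G" using subgroup.rcosets_carrier[OF H is_group] by simp
    then show "C #> inv (g \<otimes> h) = (C #> inv h) #> inv g"
      using gh by (simp add: coset_mult_assoc inv_mult_group)
  qed
  have "g \<in> H" if g: "g \<in> carrier G" for g
  proof -
    have HR: "H \<in> rcosets H" using coset_mult_one[OF HC] one_closed by (force simp: RCOSETS_def)
    have "?\<psi> g = id" using R.trivial_if_acts_trivially_below[OF below small g] .
    then have "H #> inv g = H" using HR by (auto simp: fun_eq_iff split: if_splits)
    then have "inv g \<in> H" using rcos_self[OF inv_closed[OF g] H] by simp
    then have "inv (inv g) \<in> H" by (rule subgroup.m_inv_closed[OF H])
    then show ?thesis using g by simp
  qed
  then have "carrier G \<subseteq> H" by (rule subsetI)
  then show ?thesis using HC by (rule equalityI[rotated])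
qed

theorem proposition7:
  fixes n :: nat
  assumes "n \<ge> 5"
  shows "(\<forall>r::nat. 2 \<le> r \<and> r \<le> n - 1 \<longrightarrow>
            \<not> (\<exists>H. subgroup H (braid_commutator_group n) \<and>
                 card (rcosets\<^bsub>braid_commutator_group n\<^esub> H) = r)) \<and>
         (\<forall>\<rho> \<in> hom (braid_commutator_group n) (sym_group n).
            \<not> trivial_hom (braid_commutator_group n) (sym_group n) \<rho> \<longrightarrow>
            transitive_hom (braid_commutator_group n) n \<rho>)"
proof (intro conjI allI impI notI ballI)
  let ?K = "braid_commutator_group n"
  interpret K: group ?K by (rule group_braid_commutator_group)
  have below: "acts_trivially_below ?K n"
    unfolding braid_commutator_group_def
    by (rule commutator_subgroup_acts_trivially_below[OF braid_generated_braid_group[OF assms]])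
  {
    fix r assume r: "2 \<le> r \<and> r \<le> n - 1"
    assume "\<exists>H. subgroup H ?K \<and> card (rcosets\<^bsub>?K\<^esub> H) = r"
    then obtain H where H: "subgroup H ?K" and card: "card (rcosets\<^bsub>?K\<^esub> H) = r" by blast
    have "finite (rcosets\<^bsub>?K\<^esub> H)" using card r card.infinite by fastforce
    moreover have "card (rcosets\<^bsub>?K\<^esub> H) < n" using card r assms by linarith
    ultimately have "H = carrier ?K" by (rule K.subgroup_of_small_index_eq[OF below H])
    then have "rcosets\<^bsub>?K\<^esub> H \<subseteq> {carrier ?K}"
      using K.coset_join2 H by (auto simp: RCOSETS_def)
    then have "card (rcosets\<^bsub>?K\<^esub> H) \<le> card {carrier ?K}" by (intro card_mono) auto
    then show False using card r by simp
  }
  fix \<rho> assume hom: "\<rho> \<in> hom ?K (sym_group n)" and nontriv: "\<not> trivial_hom ?K (sym_group n) \<rho>"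
  interpret R: perm_rep ?K \<rho> "{1..n}"
  proof
    show "\<rho> g permutes {1..n}" if "g \<in> carrier ?K" for g
      using hom_in_carrier[OF hom that] by (simp add: sym_group_carrier)
    show "\<rho> (g \<otimes>\<^bsub>?K\<^esub> h) = \<rho> g \<circ> \<rho> h" if "g \<in> carrier ?K" "h \<in> carrier ?K" for g h
      using hom_mult[OF hom that] by (simp add: sym_group_mult)
  qed simp
  show "transitive_hom ?K n \<rho>"
  proof (rule ccontr)
    assume "\<not> transitive_hom ?K n \<rho>"
    then obtain i j where ij: "i \<in> {1..n}" "j \<in> {1..n}" "\<And>g. g \<in> carrier ?K \<Longrightarrow> \<rho> g i \<noteq> j"
      unfolding transitive_hom_def by blast
    define Y where "Y = (\<lambda>g. \<rho> g i) ` carrier ?K"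
    have Y: "Y \<subseteq> {1..n}" "j \<notin> Y" "i \<in> Y"
      using ij R.in_image R.one K.one_closed by (auto simp: Y_def intro!: image_eqI[of _ _ "\<one>\<^bsub>?K\<^esub>"])
    have Oinv: "\<rho> g x \<in> Y" if g: "g \<in> carrier ?K" and x: "x \<in> Y" for g x
    proof -
      obtain h where h: "h \<in> carrier ?K" "x = \<rho> h i" using x by (auto simp: Y_def)
      have "\<rho> g x = \<rho> (g \<otimes>\<^bsub>?K\<^esub> h) i" using R.mult[OF g h(1)] h(2) by simp
      then show ?thesis using K.m_closed[OF g h(1)] by (simp add: Y_def)
    qed
    have Cinv: "\<rho> g x \<in> {1..n} - Y" if "g \<in> carrier ?K" "x \<in> {1..n} - Y" for g x
    proof -
      have "\<rho> g x \<notin> Y" using Oinv[of "inv\<^bsub>?K\<^esub> g" "\<rho> g x"] R.inv_left that by auto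
      then show ?thesis using R.in_image[OF that(1)] that(2) by blast
    qed
    have small: "card Y < n" "card ({1..n} - Y) < n"
    proof -
      have "Y \<subset> {1..n}" "{1..n} - Y \<subset> {1..n}" using Y ij by auto
      then have "card Y < card {1..n}" "card ({1..n} - Y) < card {1..n}"
        using psubset_card_mono[OF finite_atLeastAtMost] by blast+
      then show "card Y < n" "card ({1..n} - Y) < n" by simp_all
    qed
    have "\<rho> g = id" if g: "g \<in> carrier ?K" for g
    proof
      fix x
      consider "x \<in> Y" | "x \<in> {1..n} - Y" | "x \<notin> {1..n}" by blast
      then show "\<rho> g x = id x"
      proof cases
        case 1
        then show ?thesis using R.fixes_invariant_subset[OF below Y(1) small(1) Oinv g] by simp
      next
        case 2
        then show ?thesis using R.fixes_invariant_subset[OF below _ small(2) Cinv g] by auto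
      next
        case 3
        then show ?thesis using R.permutes[OF g] permutes_not_in by fastforce
      qed
    qed
    then have "trivial_hom ?K (sym_group n) \<rho>" by (simp add: trivial_hom_def sym_group_one)
    then show False using nontriv by contradiction
  qed
qed

end
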